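(* For a class $\mathcal C$ of finite ordered graphs the following are equivalent: (1) $\mathcal C$ has bounded twin-width; (2) $\sup_{G\in\mathcal C}\mathrm{fw}_r(G)<\infty$ for every $r\in\mathbb N$; (3) $\sup_{G\in\mathcal C}\mathrm{fw}_5(G)<\infty$; (4) $\sup_{G\in\mathcal C}\mathrm{fw}^<_r(G)<\infty$ for every $r\in\mathbb N$; (5) $\sup_{G\in\mathcal C}\mathrm{fw}^<_1(G)<\infty$.
   Context: An ordered graph $G=(V,E,<)$ consists of a finite simple undirected graph $(V,E)$ and a total order $<$ on $V$, viewed as a structure with the two binary relations $E$ and $<$. Twin-width: disjoint $A,B\subseteq V$ are homogeneous if (all pairs $a\in A,b\in B$ are $E$-adjacent or none are) and (either $a<b$ for all $a\in A,b\in B$ or $b<a$ for all such pairs). An uncontraction sequence is a sequence of partitions $\mathcal P_1,\dots,\mathcal P_n$ of $V$ from the one-part partition to singletons, each step splitting one part into two; the red graph of $\mathcal P_i$ joins distinct non-homogeneous parts; the twin-width is the least $d$ such that some uncontraction sequence has all red graphs of maximum degree at most $d$. Flips of binary structures: for a partition $\mathcal P$ of $V$, a $\mathcal P$-flip is specified by binary relations $E_F,<_F$ on $\mathcal P$ and replaces each relation $R\in\{E,<\}$ by $R\,\triangle\,\bigcup_{(P,Q)\in R_F}P\times Q$; a $k$-flip uses some $\mathcal P$ with $|\mathcal P|\le k$. The Gaifman graph of a structure joins distinct $u,v$ if $(u,v)$ or $(v,u)$ lies in some relation. Flipper game of radius $r$ and width $k$: $G_0=G$, runner chooses $v_0$;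 in round $i\ge1$ the flipper announces a $k$-flip $G_i$ of $G$, runner moves from $v_{i-1}$ to $v_i$ along a path of length at most $r$ in the Gaifman graph of $G_{i-1}$; flipper wins if $v_i$ is isolated in the Gaifman graph of $G_i$; $\mathrm{fw}_r(G)$ is the least $k$ for which the flipper wins. Ordered flip-width: a $k$-cut-flip of $G$ is a triple $(V,E',S)$ where $(V,E')$ is a $k$-flip of the graph $(V,E)$ (partition of $V$ into at most $k$ parts, inverting adjacency between distinct vertices of some pairs of possibly equal parts) and $S\subseteq V$, $|S|\le k$. Let $u\sim_S v$ iff $u=v$, or there is no $s\in S$ with $\min(u,v)\le s\le\max(u,v)$. The associated weighted graph has edges $uv$ ($u\neq v$) with $uv\in E'$ (weight $1$) or $u\sim_S v$ (weight $0$). In the ordered flipper game of radius $r$ and width $k$, in round $i\ge1$ the flipper announces a $k$-cut-flip $G_i$; in round $1$ the runner picks $v_1$ arbitrarily, and in round $i\ge2$ the runner moves from $v_{i-1}$ to $v_i$ along a path of total weight at most $r$ in the weighted graph of $G_{i-1}$; the flipper wins if $v_i$ is isolated in the weighted graph of $G_i$. $\mathrm{fw}^<_r(G)$ is the least $k$ for which the flipper has a winning strategy. *)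

theory Defs
  imports Main "HOL-Library.Disjoint_Sets"
begin

definition ordered_graph :: "'a set \<Rightarrow> 'a rel \<Rightarrow> 'a rel \<Rightarrow> bool" where
  "ordered_graph V E L \<longleftrightarrow> finite V \<and> E \<subseteq> V \<times> V \<and> sym E \<and> (\<forall>x. (x, x) \<notin> E)
     \<and> L \<subseteq> V \<times> V \<and> (\<forall>x. (x, x) \<notin> L) \<and> trans L
     \<and> (\<forall>x\<in>V. \<forall>y\<in>V. x \<noteq> y \<longrightarrow> (x, y) \<in> L \<or> (y, x) \<in> L)"

definition homogeneous :: "'a rel \<Rightarrow> 'a rel \<Rightarrow> 'a set \<Rightarrow> 'a set \<Rightarrow> bool" where
  "homogeneous E L A B \<longleftrightarrow>
     ((\<forall>a\<in>A. \<forall>b\<in>B. (a, b) \<in> E) \<or> (\<forall>a\<in>A. \<forall>b\<in>B. (a, b) \<notin> E)) \<and>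
     ((\<forall>a\<in>A. \<forall>b\<in>B. (a, b) \<in> L) \<or> (\<forall>a\<in>A. \<forall>b\<in>B. (b, a) \<in> L))"

definition split_step :: "'a set set \<Rightarrow> 'a set set \<Rightarrow> bool" where
  "split_step P Q \<longleftrightarrow> (\<exists>X\<in>P. \<exists>A B. A \<noteq> {} \<and> B \<noteq> {} \<and> A \<inter> B = {} \<and> A \<union> B = X
      \<and> Q = (P - {X}) \<union> {A, B})"

definition uncontraction_seq :: "'a set \<Rightarrow> 'a set set list \<Rightarrow> bool" where
  "uncontraction_seq V Ps \<longleftrightarrow> Ps \<noteq> [] \<and> hd Ps = {V} \<and> last Ps = (\<lambda>v. {v}) ` V
     \<and> (\<forall>i. Suc i < length Ps \<longrightarrow> split_step (Ps ! i) (Ps ! Suc i))"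

definition red_degree :: "'a rel \<Rightarrow> 'a rel \<Rightarrow> 'a set set \<Rightarrow> 'a set \<Rightarrow> nat" where
  "red_degree E L P X = card {Y \<in> P. Y \<noteq> X \<and> \<not> homogeneous E L X Y}"

text \<open>Convention: the graph with no vertices has twin-width 0.\<close>
definition tww_at_most :: "'a set \<Rightarrow> 'a rel \<Rightarrow> 'a rel \<Rightarrow> nat \<Rightarrow> bool" where
  "tww_at_most V E L d \<longleftrightarrow> V = {} \<or>
     (\<exists>Ps. uncontraction_seq V Ps \<and> (\<forall>P\<in>set Ps. \<forall>X\<in>P. red_degree E L P X \<le> d))"

definition twin_width :: "'a set \<Rightarrow> 'a rel \<Rightarrow> 'a rel \<Rightarrow> nat" where
  "twin_width V E L = (LEAST d. tww_at_most V E L d)"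

definition flip_rel :: "('a set \<times> 'a set) set \<Rightarrow> 'a rel \<Rightarrow> 'a rel" where
  "flip_rel F R = (let D = (\<Union>(A, B)\<in>F. A \<times> B) in (R - D) \<union> (D - R))"

definition is_kflip :: "'a set \<Rightarrow> nat \<Rightarrow> 'a rel \<times> 'a rel \<Rightarrow> 'a rel \<times> 'a rel \<Rightarrow> bool" where
  "is_kflip V k G H \<longleftrightarrow> (\<exists>P EF LF. partition_on V P \<and> card P \<le> k \<and> EF \<subseteq> P \<times> P \<and> LF \<subseteq> P \<times> P
     \<and> H = (flip_rel EF (fst G), flip_rel LF (snd G)))"

definition gaifman :: "'a rel \<times> 'a rel \<Rightarrow> 'a rel" where
  "gaifman H = {(u, v). u \<noteq> v \<and> ((u, v) \<in> fst H \<or> (v, u) \<in> fst H \<or> (u, v) \<in> snd H \<or> (v, u) \<in> snd H)}"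

definition gisolated :: "'a rel \<times> 'a rel \<Rightarrow> 'a \<Rightarrow> bool" where
  "gisolated H v \<longleftrightarrow> (\<forall>u. (v, u) \<notin> gaifman H)"

text \<open>flipper_wins_from V E L r k H v: in the flipper game of radius r and width k on the
  structure (V,E,L), the flipper has a winning strategy from the position where the previous
  structure is H (= G_{i-1}) and the runner stands on v (= v_{i-1}). Least fixed point,
  i.e. the flipper wins after finitely many rounds.\<close>
inductive flipper_wins_from :: "'a set \<Rightarrow> 'a rel \<Rightarrow> 'a rel \<Rightarrow> nat \<Rightarrow> nat \<Rightarrow> 'a rel \<times> 'a rel \<Rightarrow> 'a \<Rightarrow> bool"
  for V E L r k where
  step: "is_kflip V k (E, L) H' \<Longrightarrow>
    (\<forall>v'. (v, v') \<in> (\<Union>i\<in>{..r}. gaifman H ^^ i) \<longrightarrow> gisolated H' v' \<or> flipper_wins_from V E L r k H' v')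
    \<Longrightarrow> flipper_wins_from V E L r k H v"

definition flipper_wins :: "nat \<Rightarrow> nat \<Rightarrow> 'a set \<Rightarrow> 'a rel \<Rightarrow> 'a rel \<Rightarrow> bool" where
  "flipper_wins r k V E L \<longleftrightarrow> (\<forall>v0\<in>V. flipper_wins_from V E L r k (E, L) v0)"

definition fw :: "nat \<Rightarrow> 'a set \<Rightarrow> 'a rel \<Rightarrow> 'a rel \<Rightarrow> nat" where
  "fw r V E L = (LEAST k. flipper_wins r k V E L)"

text \<open>A k-cut-flip (V, E', S) is represented by the pair (E', S).\<close>
definition cut_flip :: "'a set \<Rightarrow> 'a rel \<Rightarrow> nat \<Rightarrow> 'a rel \<times> 'a set \<Rightarrow> bool" where
  "cut_flip V E k C \<longleftrightarrow>
     (\<exists>P F. partition_on V P \<and> card P \<le> k \<and> F \<subseteq> P \<times> P \<and>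
        (let D = {(x, y). x \<noteq> y \<and> (\<exists>(A, B)\<in>F. (x \<in> A \<and> y \<in> B) \<or> (x \<in> B \<and> y \<in> A))}
         in fst C = (E - D) \<union> (D - E)))
     \<and> snd C \<subseteq> V \<and> card (snd C) \<le> k"

definition ole :: "'a rel \<Rightarrow> 'a \<Rightarrow> 'a \<Rightarrow> bool" where
  "ole L a b \<longleftrightarrow> a = b \<or> (a, b) \<in> L"

definition sim_cut :: "'a rel \<Rightarrow> 'a set \<Rightarrow> 'a \<Rightarrow> 'a \<Rightarrow> bool" where
  "sim_cut L S u v \<longleftrightarrow> u = v \<or>
     \<not> (\<exists>s\<in>S. (ole L u s \<and> ole L s v) \<or> (ole L v s \<and> ole L s u))"

text \<open>Weight-0 edges and weight-1 edges of the weighted graph of a cut-flip.\<close>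
definition zero_edges :: "'a set \<Rightarrow> 'a rel \<Rightarrow> 'a rel \<times> 'a set \<Rightarrow> 'a rel" where
  "zero_edges V L C = {(u, v). u \<in> V \<and> v \<in> V \<and> u \<noteq> v \<and> sim_cut L (snd C) u v}"

definition one_edges :: "'a rel \<times> 'a set \<Rightarrow> 'a rel" where
  "one_edges C = {(u, v). u \<noteq> v \<and> (u, v) \<in> fst C}"

inductive wreach :: "'a rel \<Rightarrow> 'a rel \<Rightarrow> nat \<Rightarrow> 'a \<Rightarrow> 'a \<Rightarrow> bool" for Z W where
  refl: "wreach Z W n u u"
| zero: "(u, w) \<in> Z \<Longrightarrow> wreach Z W n w v \<Longrightarrow> wreach Z W n u v"
| one: "(u, w) \<in> W \<Longrightarrow> wreach Z W n w v \<Longrightarrow> wreach Z W (Suc n) u v"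

definition oisolated :: "'a set \<Rightarrow> 'a rel \<Rightarrow> 'a rel \<times> 'a set \<Rightarrow> 'a \<Rightarrow> bool" where
  "oisolated V L C v \<longleftrightarrow> (\<forall>u. (v, u) \<notin> zero_edges V L C \<and> (v, u) \<notin> one_edges C)"

inductive ordered_wins_from :: "'a set \<Rightarrow> 'a rel \<Rightarrow> 'a rel \<Rightarrow> nat \<Rightarrow> nat \<Rightarrow> 'a rel \<times> 'a set \<Rightarrow> 'a \<Rightarrow> bool"
  for V E L r k where
  step: "cut_flip V E k C' \<Longrightarrow>
    (\<forall>v'. wreach (zero_edges V L C) (one_edges C) r v v' \<longrightarrow>
          oisolated V L C' v' \<or> ordered_wins_from V E L r k C' v')
    \<Longrightarrow> ordered_wins_from V E L r k C v"

definition ordered_flipper_wins :: "nat \<Rightarrow> nat \<Rightarrow> 'a set \<Rightarrow> 'a rel \<Rightarrow> 'a rel \<Rightarrow> bool" where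
  "ordered_flipper_wins r k V E L \<longleftrightarrow>
     (\<exists>C1. cut_flip V E k C1 \<and> (\<forall>v1\<in>V. oisolated V L C1 v1 \<or> ordered_wins_from V E L r k C1 v1))"

definition ofw :: "nat \<Rightarrow> 'a set \<Rightarrow> 'a rel \<Rightarrow> 'a rel \<Rightarrow> nat" where
  "ofw r V E L = (LEAST k. ordered_flipper_wins r k V E L)"

end

theory Submission
  imports Defs
begin

text \<open>
  Small twin-width gives the flipper a winning strategy. Following an uncontraction sequence, he
  announces in each round the flip that deletes all adjacencies between homogeneous pairs of parts
  near the runner in the red graph; for cut-flips he also cuts at the ends of those parts. The
  runner can then only move along red edges, and there are none left once all parts are singletons.

  A \<open>k\<close>-flip of a linear order has the following rigidity: if \<open>S\<close> consists of the largest elements of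
  the parts, then \<open>u \<sim>\<^sub>S v\<close> implies distance at most \<open>2\<close> in the Gaifman graph of the flip. A path
  of weight at most \<open>1\<close> in the corresponding cut-flip therefore becomes a path of length at most
  \<open>2 + 1 + 2 = 5\<close>.

  Finally, starting from the division of \<open>V\<close> into singletons, merge two consecutive intervals as long
  as their union has few neighbourhoods outside few intervals. If this gets stuck, pairing up the
  intervals yields a rich division, in which the runner survives the ordered game of radius \<open>1\<close>: he
  stays in intervals that are not hit by the current cut, and richness always provides an edge of
  the flip into another such interval. If it does not get stuck, splitting the intervals of the
  divisions into classes of equal neighbourhoods outside the bad intervals yields partitions with
  bounded red degree.
\<close>

section \<open>Partitions and uncontraction sequences\<close>

definition kernel_partition :: "'a set \<Rightarrow> ('a \<Rightarrow> 'b) \<Rightarrow> 'a set set" where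
  "kernel_partition V h = (\<lambda>x. {y \<in> V. h y = h x}) ` V"

lemma partition_on_kernel: "partition_on V (kernel_partition V h)"
  unfolding kernel_partition_def by (rule partition_onI) (auto simp: disjnt_def)

lemma card_kernel_partition:
  assumes "finite V"
  shows "card (kernel_partition V h) = card (h ` V)"
proof -
  have "bij_betw (\<lambda>c. {y \<in> V. h y = c}) (h ` V) (kernel_partition V h)"
    unfolding bij_betw_def kernel_partition_def inj_on_def by (auto simp: image_image)
  then show ?thesis by (simp add: bij_betw_same_card)
qed

lemma partition_on_unique:
  assumes "partition_on V P" "X \<in> P" "Y \<in> P" "x \<in> X" "x \<in> Y"
  shows "X = Y"
  using assms by (metis IntI disjointD empty_iff partition_onD2)

lemma partition_on_eq_if_subset:
  assumes "partition_on V P" "partition_on V Q" "P \<subseteq> Q"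
  shows "P = Q"
proof -
  have "X \<in> P" if X: "X \<in> Q" for X
  proof -
    obtain x where x: "x \<in> X" using assms(2) X by (metis all_not_in_conv partition_onD3)
    then have "x \<in> V" using assms(2) X by (metis Union_iff partition_onD1)
    then obtain Y where Y: "Y \<in> P" "x \<in> Y" using assms(1) by (metis Union_iff partition_onD1)
    then show ?thesis using partition_on_unique[OF assms(2) X, of Y x] assms(3) x by blast
  qed
  then show ?thesis using assms(3) by blast
qed

lemma partition_on_split:
  assumes P: "partition_on V P" and split: "split_step P Q"
  shows "refines V Q P" and "finite V \<Longrightarrow> card Q = Suc (card P)"
proof -
  obtain X A B where X: "X \<in> P" and ne: "A \<noteq> {}" "B \<noteq> {}" and dis: "A \<inter> B = {}" and un: "A \<union> B = X"
    and Q: "Q = (P - {X}) \<union> {A, B}"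
    using split unfolding split_step_def by blast
  have other: "Y \<inter> X = {}" if "Y \<in> P" "Y \<noteq> X" for Y
    using partition_on_unique[OF P that(1) X] that(2) by blast
  have A: "A \<notin> P" "B \<notin> P" "A \<noteq> B"
    using other[of A] other[of B] ne dis un by blast+
  have part: "partition_on V Q"
  proof (rule partition_onI)
    show "\<Union>Q = V" using partition_onD1[OF P] Q X un by blast
    show "{} \<notin> Q" using partition_onD3[OF P] Q ne by blast
    show "disjnt p p'" if pp: "p \<in> Q" "p' \<in> Q" "p \<noteq> p'" for p p'
    proof -
      have "(p \<in> P \<and> p \<noteq> X) \<or> p = A \<or> p = B" "(p' \<in> P \<and> p' \<noteq> X) \<or> p' = A \<or> p' = B" "A \<subseteq> X" "B \<subseteq> X"
        using pp Q un by auto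
      then consider "p \<in> P" "p' \<in> P" "p \<noteq> X" "p' \<noteq> X" | "p \<in> P" "p \<noteq> X" "p' \<subseteq> X" | "p' \<in> P" "p' \<noteq> X" "p \<subseteq> X"
        | "p = A \<and> p' = B \<or> p = B \<and> p' = A"
        using pp(3) by metis
      then show ?thesis
      proof cases
        case 1 then show ?thesis using partition_on_unique[OF P] pp(3) by (meson disjnt_iff)
      next
        case 2 then show ?thesis using other[of p] by (auto simp: disjnt_def)
      next
        case 3 then show ?thesis using other[of p'] by (auto simp: disjnt_def)
      next
        case 4 then show ?thesis using dis by (auto simp: disjnt_def)
      qed
    qed
  qed
  show "refines V Q P"
    unfolding refines_def using part P Q X un by blast
  assume "finite V"
  then have "finite P" using P finite_elements by blast
  moreover have "Q = insert A (insert B (P - {X}))" using Q by blast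
  ultimately show "card Q = Suc (card P)" using A X
    by (simp add: card_Diff_singleton) (metis One_nat_def Suc_pred card_gt_0_iff empty_iff)
qed

text \<open>Parts of \<open>Q\<close> are split off one at a time. The chain records that every
  intermediate partition lies between \<open>Q\<close> and \<open>P\<close>, because that is all the
  later estimates of its red degree rely on.\<close>

lemma refines_by_splits:
  assumes "finite V" "refines V Q P"
  shows "(\<lambda>A B. split_step A B \<and> refines V Q B \<and> refines V B P)\<^sup>*\<^sup>* P Q"
  using assms(2)
proof (induction "card V - card P" arbitrary: P rule: less_induct)
  case less
  have P: "partition_on V P" and Q: "partition_on V Q" and QP: "\<And>Z. Z \<in> Q \<Longrightarrow> \<exists>X\<in>P. Z \<subseteq> X"
    using less.prems unfolding refines_def by auto
  show ?case
  proof (cases "P = Q")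
    case True then show ?thesis by simp
  next
    case False
    then obtain X where X: "X \<in> P" "X \<notin> Q" using partition_on_eq_if_subset[OF P Q] by blast
    obtain x where x: "x \<in> X" using P X partition_onD3[OF P] by fastforce
    then have "x \<in> V" using P X by (metis Union_iff partition_onD1)
    then obtain Y where Y: "Y \<in> Q" "x \<in> Y" using Q by (metis Union_iff partition_onD1)
    obtain X' where X': "X' \<in> P" "Y \<subseteq> X'" using QP Y by blast
    have "X' = X" using partition_on_unique[OF P X'(1) X(1) _ x] Y X' by blast
    then have YX: "Y \<subset> X" using X' Y X by blast
    define P' where "P' = (P - {X}) \<union> {Y, X - Y}"
    have split: "split_step P P'"
      unfolding split_step_def P'_def using X(1) YX Y(2)
      by (intro bexI[of _ X] exI[of _ Y] exI[of _ "X - Y"]) auto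
    note part = partition_on_split[OF P split]
    have P'p: "partition_on V P'" using part(1) unfolding refines_def by blast
    have "refines V Q P'"
    proof -
      have "\<exists>W\<in>P'. Z \<subseteq> W" if Z: "Z \<in> Q" for Z
      proof -
        obtain W where W: "W \<in> P" "Z \<subseteq> W" using QP Z by blast
        show ?thesis
        proof (cases "W = X")
          case True
          have "Z = Y \<or> Z \<inter> Y = {}" using partition_on_unique[OF Q Z Y(1)] by blast
          then show ?thesis using True W unfolding P'_def by blast
        next
          case False then show ?thesis using W unfolding P'_def by blast
        qed
      qed
      then show ?thesis using Q P'p unfolding refines_def by blast
    qed
    \<comment> \<open>Picking one element per part injects \<open>P'\<close> into \<open>V\<close>;
      without this bound the truncated difference \<open>card V - card P\<close> could already be
      0.\<close>
    moreover have "card P' \<le> card V"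
    proof -
      have "inj_on (\<lambda>X. SOME x. x \<in> X) P'"
      proof (rule inj_onI)
        fix A B assume AB: "A \<in> P'" "B \<in> P'" "(SOME x. x \<in> A) = (SOME x. x \<in> B)"
        have "(SOME x. x \<in> A) \<in> A" "(SOME x. x \<in> B) \<in> B"
          using AB partition_onD3[OF P'p] by (metis all_not_in_conv someI)+
        then show "A = B" using AB partition_on_unique[OF P'p AB(1,2)] by metis
      qed
      moreover have "(\<lambda>X. SOME x. x \<in> X) ` P' \<subseteq> V"
        using partition_onD1[OF P'p] partition_onD3[OF P'p]
        by clarsimp (metis UnionI all_not_in_conv someI)
      ultimately show ?thesis using assms(1) card_inj_on_le by blast
    qed
    ultimately have steps: "(\<lambda>A B. split_step A B \<and> refines V Q B \<and> refines V B P')\<^sup>*\<^sup>* P' Q"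
      using less.hyps[of P'] part(2)[OF assms(1)] by linarith
    have "(\<lambda>A B. split_step A B \<and> refines V Q B \<and> refines V B P)\<^sup>*\<^sup>* P' Q" (is "?R\<^sup>*\<^sup>* _ _")
      by (rule mono_rtranclp[rule_format, OF _ steps]) (use refines_trans part(1) in blast)
    moreover have "?R P P'" using split part(1) \<open>refines V Q P'\<close> by blast
    ultimately show ?thesis by (rule converse_rtranclp_into_rtranclp[rotated])
  qed
qed

text \<open>Only the new partition is tested: an uncontraction sequence starts at
  \<open>{V}\<close>, which has a single part and hence no red edge.\<close>

definition bounded_split :: "'a rel \<Rightarrow> 'a rel \<Rightarrow> nat \<Rightarrow> 'a set set \<Rightarrow> 'a set set \<Rightarrow> bool" where
  "bounded_split E L d P Q \<longleftrightarrow> split_step P Q \<and> (\<forall>X\<in>Q. red_degree E L Q X \<le> d)"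

lemma red_degree_singleton [simp]: "red_degree E L {V} V = 0"
  by (simp add: red_degree_def)

lemma tww_at_most_iff_bounded_splits:
  assumes "V \<noteq> {}"
  shows "tww_at_most V E L d \<longleftrightarrow> (bounded_split E L d)\<^sup>*\<^sup>* {V} ((\<lambda>v. {v}) ` V)"
proof
  assume "tww_at_most V E L d"
  then obtain Ps where Ps: "uncontraction_seq V Ps" and deg: "\<forall>P\<in>set Ps. \<forall>X\<in>P. red_degree E L P X \<le> d"
    using assms unfolding tww_at_most_def by blast
  have "(bounded_split E L d)\<^sup>*\<^sup>* (Ps ! 0) (Ps ! i)" if "i < length Ps" for i
    using that
  proof (induction i)
    case (Suc i)
    have "bounded_split E L d (Ps ! i) (Ps ! Suc i)"
      using Ps deg Suc.prems unfolding uncontraction_seq_def bounded_split_def by auto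
    then show ?case using Suc by (meson Suc_lessD rtranclp.rtrancl_into_rtrancl)
  qed simp
  moreover have "Ps ! 0 = {V}" "Ps ! (length Ps - 1) = (\<lambda>v. {v}) ` V" "length Ps - 1 < length Ps"
    using Ps unfolding uncontraction_seq_def by (auto simp: hd_conv_nth last_conv_nth)
  ultimately show "(bounded_split E L d)\<^sup>*\<^sup>* {V} ((\<lambda>v. {v}) ` V)" by metis
next
  assume "(bounded_split E L d)\<^sup>*\<^sup>* {V} ((\<lambda>v. {v}) ` V)"
  then have "\<exists>Ps. Ps \<noteq> [] \<and> hd Ps = {V} \<and> last Ps = ((\<lambda>v. {v}) ` V)
     \<and> (\<forall>i. Suc i < length Ps \<longrightarrow> split_step (Ps ! i) (Ps ! Suc i)) \<and> (\<forall>P\<in>set Ps. \<forall>X\<in>P. red_degree E L P X \<le> d)"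
  proof (induction rule: rtranclp_induct)
    case base
    then show ?case by (intro exI[of _ "[{V}]"]) simp
  next
    case (step P Q)
    then obtain Ps where Ps: "Ps \<noteq> []" "hd Ps = {V}" "last Ps = P"
      "\<forall>i. Suc i < length Ps \<longrightarrow> split_step (Ps ! i) (Ps ! Suc i)"
      "\<forall>P\<in>set Ps. \<forall>X\<in>P. red_degree E L P X \<le> d" by blast
    have "split_step ((Ps @ [Q]) ! i) ((Ps @ [Q]) ! Suc i)" if "Suc i < length (Ps @ [Q])" for i
    proof (cases "Suc i < length Ps")
      case True
      then show ?thesis using Ps(4) by (simp add: nth_append)
    next
      case False
      then have "i = length Ps - 1" using that by simp
      then have "Ps ! i = P" "Suc i = length Ps" "i < length Ps"
        using Ps(1,3) by (auto simp: last_conv_nth)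
      then show ?thesis using step.hyps unfolding bounded_split_def by (simp add: nth_append)
    qed
    then show ?case using Ps step.hyps unfolding bounded_split_def
      by (intro exI[of _ "Ps @ [Q]"]) auto
  qed
  then show "tww_at_most V E L d" unfolding tww_at_most_def uncontraction_seq_def by blast
qed

section \<open>Finite ordered graphs\<close>

locale fin_ordered_graph =
  fixes V :: "'a set" and E L :: "'a rel"
  assumes og: "ordered_graph V E L"
begin

lemma finite_V [simp]: "finite V" using og by (simp add: ordered_graph_def)
lemma E_subset: "(x, y) \<in> E \<Longrightarrow> x \<in> V \<and> y \<in> V" using og by (auto simp: ordered_graph_def)
lemma E_sym: "(x, y) \<in> E \<Longrightarrow> (y, x) \<in> E" using og by (auto simp: ordered_graph_def sym_def)
lemma E_irrefl [simp]: "(x, x) \<notin> E" using og by (auto simp: ordered_graph_def)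
lemma L_subset: "(x, y) \<in> L \<Longrightarrow> x \<in> V \<and> y \<in> V" using og by (auto simp: ordered_graph_def)
lemma L_irrefl [simp]: "(x, x) \<notin> L" using og by (auto simp: ordered_graph_def)
lemma L_trans: "(x, y) \<in> L \<Longrightarrow> (y, z) \<in> L \<Longrightarrow> (x, z) \<in> L"
  using og by (auto simp: ordered_graph_def trans_def)
lemma L_asym: "(x, y) \<in> L \<Longrightarrow> (y, x) \<notin> L" using L_trans L_irrefl by blast
lemma L_total: "x \<in> V \<Longrightarrow> y \<in> V \<Longrightarrow> x \<noteq> y \<Longrightarrow> (x, y) \<in> L \<or> (y, x) \<in> L"
  using og by (auto simp: ordered_graph_def)

lemma ole_total: "x \<in> V \<Longrightarrow> y \<in> V \<Longrightarrow> ole L x y \<or> (y, x) \<in> L"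
  using L_total by (auto simp: ole_def)

lemma ole_trans: "ole L x y \<Longrightarrow> ole L y z \<Longrightarrow> ole L x z"
  using L_trans by (auto simp: ole_def)

lemma homogeneous_sym: "homogeneous E L A B \<Longrightarrow> homogeneous E L B A"
  unfolding homogeneous_def using E_sym by meson

lemma homogeneous_mono: "homogeneous E L A B \<Longrightarrow> A' \<subseteq> A \<Longrightarrow> B' \<subseteq> B \<Longrightarrow> homogeneous E L A' B'"
  unfolding homogeneous_def by blast

lemma ex_greatest:
  assumes "A \<subseteq> V" "A \<noteq> {}"
  shows "\<exists>m\<in>A. \<forall>a\<in>A. ole L a m"
proof -
  have "finite A" using assms finite_subset finite_V by blast
  then show ?thesis using assms(2,1)
  proof (induction rule: finite_ne_induct)
    case (singleton x) then show ?case by (simp add: ole_def)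
  next
    case (insert x F)
    then obtain m where m: "m \<in> F" "\<forall>a\<in>F. ole L a m" by blast
    show ?case
    proof (cases "ole L x m")
      case True then show ?thesis using m by blast
    next
      case False
      then have "ole L m x" using ole_total[of x m] insert.prems m(1) unfolding ole_def by blast
      then show ?thesis using m ole_trans by (metis insert_iff ole_def)
    qed
  qed
qed

lemma ex_least:
  assumes "A \<subseteq> V" "A \<noteq> {}"
  shows "\<exists>m\<in>A. \<forall>a\<in>A. ole L m a"
proof -
  have "finite A" using assms finite_subset finite_V by blast
  then show ?thesis using assms(2,1)
  proof (induction rule: finite_ne_induct)
    case (singleton x) then show ?case by (simp add: ole_def)
  next
    case (insert x F)
    then obtain m where m: "m \<in> F" "\<forall>a\<in>F. ole L m a" by blast
    show ?case
    proof (cases "ole L m x")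
      case True then show ?thesis using m by blast
    next
      case False
      then have "ole L x m" using ole_total[of m x] insert.prems m(1) unfolding ole_def by blast
      then show ?thesis using m ole_trans by (metis insert_iff ole_def)
    qed
  qed
qed

lemma partition_on_singletons: "partition_on V ((\<lambda>v. {v}) ` V)"
  by (rule partition_onI) auto

text \<open>\<open>LEAST\<close> yields a value with the desired property only if some
  \<open>d\<close> qualifies. Any chain of splits down to singletons shows that
  \<open>card (Pow V)\<close> does, since parts are subsets of \<open>V\<close>.\<close>

lemma tww_at_most_twin_width: "tww_at_most V E L (twin_width V E L)"
proof (cases "V = {}")
  case False
  have ref: "refines V ((\<lambda>v. {v}) ` V) {V}"
    using partition_on_singletons False unfolding refines_def by (auto simp: partition_on_def disjoint_def)
  have deg: "red_degree E L Q X \<le> card (Pow V)" if "partition_on V Q" for Q X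
    unfolding red_degree_def using that
    by (intro card_mono) (auto simp: partition_on_def)
  have "(bounded_split E L (card (Pow V)))\<^sup>*\<^sup>* {V} ((\<lambda>v. {v}) ` V)"
    by (rule mono_rtranclp[rule_format, OF _ refines_by_splits[OF finite_V ref]])
       (auto simp: bounded_split_def refines_def intro: deg)
  then have "tww_at_most V E L (card (Pow V))" using tww_at_most_iff_bounded_splits[OF False] by blast
  then show ?thesis unfolding twin_width_def by (rule LeastI)
next
  case True
  then show ?thesis by (simp add: tww_at_most_def)
qed

end

section \<open>Divisions into intervals\<close>

lemma refines_kernel_partition:
  assumes "\<And>x y. x \<in> V \<Longrightarrow> y \<in> V \<Longrightarrow> h x = h y \<Longrightarrow> h' x = h' y"
  shows "refines V (kernel_partition V h) (kernel_partition V h')"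
proof -
  have "\<exists>Y\<in>kernel_partition V h'. X \<subseteq> Y" if "X \<in> kernel_partition V h" for X
  proof -
    from that obtain x where x: "x \<in> V" "X = {y \<in> V. h y = h x}" unfolding kernel_partition_def by (elim imageE)
    then have "X \<subseteq> {y \<in> V. h' y = h' x}" using assms[OF _ x(1)] by blast
    then show ?thesis using x(1) unfolding kernel_partition_def by blast
  qed
  then show ?thesis by (simp add: refines_def partition_on_kernel)
qed

lemma card_UN_le_mult:
  assumes "finite J" "\<And>j. j \<in> J \<Longrightarrow> card (A j) \<le> M"
  shows "card (\<Union>j\<in>J. A j) \<le> card J * M"
  using card_UN_le[OF assms(1), of A] sum_bounded_above[of J "\<lambda>j. card (A j)" M] assms(2) by fastforce

text \<open>Send each part of \<open>R\<close> inside \<open>X\<close> to the part of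
  \<open>Q\<close> around it. As parts are nonempty, the image covers all parts of \<open>Q\<close>
  inside \<open>X\<close>.\<close>

lemma card_parts_within_le:
  assumes "finite V" "refines V R Q"
  shows "card {Y \<in> Q. Y \<subseteq> X} \<le> card {Z \<in> R. Z \<subseteq> X}"
proof -
  have Q: "partition_on V Q" and R: "partition_on V R" and RQ: "\<And>Z. Z \<in> R \<Longrightarrow> \<exists>Y\<in>Q. Z \<subseteq> Y"
    using assms(2) unfolding refines_def by auto
  have "Y \<in> (\<lambda>Z. THE Y. Y \<in> Q \<and> Z \<subseteq> Y) ` {Z \<in> R. Z \<subseteq> X}" if Y: "Y \<in> Q" "Y \<subseteq> X" for Y
  proof -
    obtain y where y: "y \<in> Y" using partition_onD3[OF Q] Y by fastforce
    then have "y \<in> V" using Q Y by (metis Union_iff partition_onD1)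
    then obtain Z where Z: "Z \<in> R" "y \<in> Z" using R by (metis Union_iff partition_onD1)
    obtain Y' where Y': "Y' \<in> Q" "Z \<subseteq> Y'" using RQ Z by blast
    have "Y' = Y" using partition_on_unique[OF Q Y'(1) Y(1) _ y] Y' Z by blast
    moreover have "(THE Y. Y \<in> Q \<and> Z \<subseteq> Y) = Y'"
      using Y' partition_on_unique[OF Q] Z by (intro the_equality) blast+
    ultimately show ?thesis using Y Z Y' by blast
  qed
  then have "{Y \<in> Q. Y \<subseteq> X} \<subseteq> (\<lambda>Z. THE Y. Y \<in> Q \<and> Z \<subseteq> Y) ` {Z \<in> R. Z \<subseteq> X}" by blast
  then show ?thesis using finite_elements[OF assms(1) R] by (simp add: surj_card_le)
qed

text \<open>
  Divisions of \<open>V\<close> into intervals are encoded by monotone maps \<open>f\<close> from \<open>V\<close> to the natural numbers,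
  the intervals being the fibres of \<open>f\<close>; merging intervals is postcomposition with a monotone map.
\<close>

definition degree_bound :: "nat \<Rightarrow> nat" where
  "degree_bound t = (t + 1) * (t * (2 ^ t) ^ t) * (2 * (t * (2 ^ t) ^ t))"

context fin_ordered_graph
begin

definition fibre :: "('a \<Rightarrow> nat) \<Rightarrow> nat \<Rightarrow> 'a set" where
  "fibre f i = {u \<in> V. f u = i}"

definition outside :: "('a \<Rightarrow> nat) \<Rightarrow> nat set \<Rightarrow> 'a \<Rightarrow> 'a set" where
  "outside f K u = {w. (u, w) \<in> E \<and> f w \<notin> K}"

definition trace :: "('a \<Rightarrow> nat) \<Rightarrow> nat \<Rightarrow> 'a \<Rightarrow> 'a set" where
  "trace f j u = {w. (u, w) \<in> E \<and> f w = j}"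

definition good :: "('a \<Rightarrow> nat) \<Rightarrow> nat \<Rightarrow> 'a set \<Rightarrow> bool" where
  "good f t A \<longleftrightarrow> (\<exists>K. finite K \<and> card K \<le> t \<and> card (outside f K ` A) \<le> t)"

definition bad :: "('a \<Rightarrow> nat) \<Rightarrow> nat \<Rightarrow> nat \<Rightarrow> nat \<Rightarrow> bool" where
  "bad f t i j \<longleftrightarrow> t < card (trace f j ` fibre f i) \<and> t < card (trace f i ` fibre f j)"

text \<open>
  Requiring many traces in both directions makes \<open>bad\<close> symmetric, so that classes of equal profile in
  fibres that are not bad to each other are homogeneous. It is also monotone under merging, hence
  profiles only get coarser; a choice of witnesses \<open>K\<close> for \<open>good\<close> would not have this property.
\<close>

definition profile :: "('a \<Rightarrow> nat) \<Rightarrow> nat \<Rightarrow> 'a \<Rightarrow> nat \<times> 'a set" where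
  "profile f t u = (f u, {w. (u, w) \<in> E \<and> \<not> bad f t (f u) (f w)})"

abbreviation profile_partition :: "('a \<Rightarrow> nat) \<Rightarrow> nat \<Rightarrow> 'a set set" where
  "profile_partition f t \<equiv> kernel_partition V (profile f t)"

definition monotone_map :: "('a \<Rightarrow> nat) \<Rightarrow> bool" where
  "monotone_map f \<longleftrightarrow> (\<forall>(x, y)\<in>L. f x \<le> f y)"

section \<open>Counting traces and profiles\<close>

lemma finite_fibre [simp]: "finite (fibre f i)" by (simp add: fibre_def)

text \<open>A 0/1 matrix with \<open>c\<close> distinct columns has at most \<open>2 ^ c\<close>
  distinct rows, as a row is determined by the set of column types in which it has a one.\<close>

lemma card_traces_le_power: "card (trace f j ` fibre f i) \<le> 2 ^ card (trace f i ` fibre f j)"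
proof -
  have "trace f j ` fibre f i \<subseteq> (\<lambda>S. {w \<in> fibre f j. trace f i w \<in> S}) ` Pow (trace f i ` fibre f j)"
  proof (rule image_subsetI)
    fix u assume "u \<in> fibre f i"
    then have "trace f j u = {w \<in> fibre f j. trace f i w \<in> {T \<in> trace f i ` fibre f j. u \<in> T}}"
      using E_sym E_subset unfolding trace_def fibre_def by blast
    then show "trace f j u \<in> (\<lambda>S. {w \<in> fibre f j. trace f i w \<in> S}) ` Pow (trace f i ` fibre f j)"
      by blast
  qed
  then show ?thesis by (metis (no_types, lifting) card_Pow finite_Pow_iff finite_fibre finite_imageI surj_card_le)
qed

lemma card_traces_le_outside:
  assumes "finite A" "j \<notin> K"
  shows "card (trace f j ` A) \<le> card (outside f K ` A)"
proof -
  have "trace f j u = {w \<in> outside f K u. f w = j}" for u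
    using assms(2) unfolding trace_def outside_def by blast
  then have "trace f j ` A \<subseteq> (\<lambda>S. {w \<in> S. f w = j}) ` outside f K ` A" by blast
  then show ?thesis using assms(1) by (simp add: surj_card_le)
qed

text \<open>A set \<open>K\<close> witnessing goodness contains every index that is bad for
  \<open>i\<close>: on any other fibre the trace is a restriction of the neighbourhood outside
  \<open>K\<close>, so at most \<open>t\<close> traces occur.\<close>

lemma card_bad:
  assumes "good f t (fibre f i)"
  shows "finite {j. bad f t i j}" "card {j. bad f t i j} \<le> t"
proof -
  obtain K where K: "finite K" "card K \<le> t" "card (outside f K ` fibre f i) \<le> t"
    using assms unfolding good_def by blast
  have "{j. bad f t i j} \<subseteq> K"
    using card_traces_le_outside[where A = "fibre f i" and K = K and f = f] K(3)
    unfolding bad_def by fastforce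
  then show "finite {j. bad f t i j}" "card {j. bad f t i j} \<le> t"
    using K by (auto intro: finite_subset dest: card_mono[OF K(1)])
qed

text \<open>The profile of \<open>u\<close> is assembled from its neighbourhood outside
  \<open>K\<close>, with at most \<open>t\<close> choices, and its traces on the fibres of
  \<open>K\<close> that are not bad for \<open>i\<close>. Such a fibre has at most \<open>t\<close>
  traces in one of the two directions, hence at most \<open>2 ^ t\<close> in the other.\<close>

lemma card_profiles:
  assumes "good f t (fibre f i)"
  shows "card (profile f t ` fibre f i) \<le> t * (2 ^ t) ^ t"
proof -
  obtain K where K: "finite K" "card K \<le> t" "card (outside f K ` fibre f i) \<le> t"
    using assms unfolding good_def by blast
  define K' where "K' = {j \<in> K. \<not> bad f t i j}"
  have K': "finite K'" "card K' \<le> t"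
    using K unfolding K'_def by (auto intro: order_trans[OF card_mono])
  define G where "G = (\<lambda>(o', \<phi>). (i, {w \<in> o'. \<not> bad f t i (f w)} \<union> (\<Union>j\<in>K'. \<phi> j)))"
  let ?D = "(outside f K ` fibre f i) \<times> (\<Pi>\<^sub>E j\<in>K'. trace f j ` fibre f i)"
  have "profile f t ` fibre f i \<subseteq> G ` ?D"
  proof (rule image_subsetI)
    fix u assume u: "u \<in> fibre f i"
    have "profile f t u = G (outside f K u, restrict (\<lambda>j. trace f j u) K')"
      using u unfolding profile_def G_def K'_def outside_def trace_def fibre_def by auto
    moreover have "(outside f K u, restrict (\<lambda>j. trace f j u) K') \<in> ?D" using u by auto
    ultimately show "profile f t u \<in> G ` ?D" by (rule image_eqI)
  qed
  moreover have "finite ?D" using K'(1) by (intro finite_cartesian_product finite_PiE) auto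
  ultimately have "card (profile f t ` fibre f i) \<le> card ?D" by (simp add: surj_card_le)
  also have "\<dots> = card (outside f K ` fibre f i) * (\<Prod>j\<in>K'. card (trace f j ` fibre f i))"
    using K'(1) by (simp add: card_cartesian_product card_PiE)
  also have "\<dots> \<le> t * (2 ^ t) ^ t"
  proof (rule mult_le_mono[OF K(3)])
    have "card (trace f j ` fibre f i) \<le> 2 ^ t" if "j \<in> K'" for j
    proof (cases "card (trace f j ` fibre f i) \<le> t")
      case True then show ?thesis using less_exp[of t] by linarith
    next
      case False
      then have "card (trace f i ` fibre f j) \<le> t" using that unfolding K'_def bad_def by auto
      then have "(2::nat) ^ card (trace f i ` fibre f j) \<le> 2 ^ t" by simp
      then show ?thesis using card_traces_le_power order_trans by blast
    qed
    then have "(\<Prod>j\<in>K'. card (trace f j ` fibre f i)) \<le> (\<Prod>j\<in>K'. 2 ^ t)"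
      by (intro prod_mono) auto
    also have "\<dots> = (2 ^ t) ^ card K'" by simp
    also have "\<dots> \<le> (2 ^ t) ^ t" using K'(2) by (intro power_increasing) auto
    finally show "(\<Prod>j\<in>K'. card (trace f j ` fibre f i)) \<le> (2 ^ t) ^ t" .
  qed
  finally show ?thesis .
qed

text \<open>Intersecting the traces on a merged fibre with a finer fibre recovers the finer traces,
  so merging lowers the number of traces in neither direction.\<close>

lemma bad_comp: "bad f t i j \<Longrightarrow> bad (c \<circ> f) t (c i) (c j)"
proof -
  have "card (trace f j ` fibre f i) \<le> card (trace (c \<circ> f) (c j) ` fibre (c \<circ> f) (c i))" for i j
  proof -
    have "trace f j u = {w \<in> trace (c \<circ> f) (c j) u. f w = j}" for u
      unfolding trace_def by auto
    then have "trace f j ` fibre f i \<subseteq> (\<lambda>S. {w \<in> S. f w = j}) ` trace (c \<circ> f) (c j) ` fibre (c \<circ> f) (c i)"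
      unfolding fibre_def by fastforce
    then show ?thesis by (simp add: surj_card_le)
  qed
  then show "bad f t i j \<Longrightarrow> bad (c \<circ> f) t (c i) (c j)"
    unfolding bad_def by (meson order_less_le_trans)
qed

lemma profile_comp:
  assumes "profile f t u = profile f t u'"
  shows "profile (c \<circ> f) t u = profile (c \<circ> f) t u'"
proof -
  \<comment> \<open>As badness persists under merging, passing to the coarse profile only deletes
    further vertices from the fine one, so equal profiles stay equal.\<close>
  have eq: "profile (c \<circ> f) t u = (c (f u), {w \<in> snd (profile f t u). \<not> bad (c \<circ> f) t (c (f u)) (c (f w))})" for u
    using bad_comp[of f t _ _ c] unfolding profile_def by auto
  have "f u = f u'" using assms unfolding profile_def by simp
  then show ?thesis unfolding eq using assms by simp
qed

text \<open>The indices in \<open>K\<close> are replaced by their images under \<open>c\<close>: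
  there are no more of them, and the neighbourhood that remains is a restriction of the old
  one.\<close>

lemma good_comp:
  assumes "finite A" "good f t A"
  shows "good (c \<circ> f) t A"
proof -
  obtain K where K: "finite K" "card K \<le> t" "card (outside f K ` A) \<le> t"
    using assms unfolding good_def by blast
  have "outside (c \<circ> f) (c ` K) u = {w \<in> outside f K u. c (f w) \<notin> c ` K}" for u
    unfolding outside_def by auto
  then have "outside (c \<circ> f) (c ` K) ` A \<subseteq> (\<lambda>S. {w \<in> S. c (f w) \<notin> c ` K}) ` outside f K ` A"
    by blast
  then have "card (outside (c \<circ> f) (c ` K) ` A) \<le> t"
    using K(3) assms(1) by (meson finite_imageI order_trans surj_card_le)
  moreover have "card (c ` K) \<le> t" using K card_image_le order_trans by blast
  ultimately show ?thesis using K(1) unfolding good_def by blast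
qed

text \<open>Representatives are exchanged one side at a time: the profile of \<open>a\<close> allows
  \<open>a\<close> to be replaced by \<open>x\<close>, and that of \<open>b\<close> allows
  \<open>b\<close> to be replaced by \<open>y\<close>; the second exchange uses that badness is
  symmetric. The order is constant because distinct fibres are disjoint intervals.\<close>

lemma homogeneous_profile_classes:
  assumes f: "monotone_map f" and X: "X \<in> profile_partition f t" and Y: "Y \<in> profile_partition f t"
    and xy: "x \<in> X" "y \<in> Y" "f x \<noteq> f y" "\<not> bad f t (f x) (f y)"
  shows "homogeneous E L X Y"
proof -
  have X: "a \<in> V \<and> profile f t a = profile f t x" if "a \<in> X" for a
    using X xy that unfolding kernel_partition_def by force
  have Y: "a \<in> V \<and> profile f t a = profile f t y" if "a \<in> Y" for a
    using Y xy that unfolding kernel_partition_def by force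
  have fX: "f a = f x" if "a \<in> X" for a using X[OF that] unfolding profile_def by simp
  have fY: "f a = f y" if "a \<in> Y" for a using Y[OF that] unfolding profile_def by simp
  have sym: "\<not> bad f t (f y) (f x)" using xy(4) unfolding bad_def by blast
  have "(a, b) \<in> E \<longleftrightarrow> (x, y) \<in> E" if ab: "a \<in> X" "b \<in> Y" for a b
  proof -
    have "(a, b) \<in> E \<longleftrightarrow> b \<in> snd (profile f t a)"
      unfolding profile_def using fX fY ab xy(4) by simp
    also have "\<dots> \<longleftrightarrow> (x, b) \<in> E"
      using X[OF ab(1)] unfolding profile_def using fX fY ab xy(4) by simp
    also have "\<dots> \<longleftrightarrow> x \<in> snd (profile f t b)"
      unfolding profile_def using fY ab sym E_sym by auto
    also have "\<dots> \<longleftrightarrow> (y, x) \<in> E"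
      using Y[OF ab(2)] unfolding profile_def using fY ab sym by simp
    finally show ?thesis using E_sym by blast
  qed
  moreover have "(\<forall>a\<in>X. \<forall>b\<in>Y. (a, b) \<in> L) \<or> (\<forall>a\<in>X. \<forall>b\<in>Y. (b, a) \<in> L)"
  proof (cases "f x < f y")
    case True
    have "(a, b) \<in> L" if "a \<in> X" "b \<in> Y" for a b
      using L_total[of a b] X[OF that(1)] Y[OF that(2)] fX[OF that(1)] fY[OF that(2)] True f
      unfolding monotone_map_def by fastforce
    then show ?thesis by blast
  next
    case False
    then have "f y < f x" using xy by simp
    then have "(b, a) \<in> L" if "a \<in> X" "b \<in> Y" for a b
      using L_total[of a b] X[OF that(1)] Y[OF that(2)] fX[OF that(1)] fY[OF that(2)] f
      unfolding monotone_map_def by fastforce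
    then show ?thesis by blast
  qed
  ultimately show ?thesis unfolding homogeneous_def by blast
qed

lemma card_profile_classes_in_fibre:
  assumes "good f t (fibre f j)"
  shows "card {Y \<in> profile_partition f t. Y \<subseteq> fibre f j} \<le> t * (2 ^ t) ^ t"
proof -
  have "{Y \<in> profile_partition f t. Y \<subseteq> fibre f j} \<subseteq> (\<lambda>c. {y \<in> V. profile f t y = c}) ` profile f t ` fibre f j"
    unfolding kernel_partition_def by auto
  then show ?thesis
    using card_profiles[OF assms] by (meson finite_fibre finite_imageI order_trans surj_card_le)
qed

lemma profile_class_subset_fibre:
  assumes "X \<in> profile_partition f t" "x \<in> X"
  shows "X \<subseteq> fibre f (f x)"
  using assms unfolding kernel_partition_def profile_def fibre_def by auto

text \<open>A class can fail to be homogeneous to \<open>X\<close> only inside the fibre of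
  \<open>X\<close> or in one of the at most \<open>t\<close> fibres bad for it, and the number of
  classes in each fibre is already bounded.\<close>

lemma card_red_neighbours:
  assumes f: "monotone_map f" and good: "\<And>i. good f t (fibre f i)" and X: "X \<in> profile_partition f t"
  shows "card {Y \<in> profile_partition f t. Y = X \<or> \<not> homogeneous E L X Y} \<le> (t + 1) * (t * (2 ^ t) ^ t)"
proof -
  have ne: "\<exists>y. y \<in> Y" if "Y \<in> profile_partition f t" for Y
    using that unfolding kernel_partition_def by auto
  obtain x where x: "x \<in> X" using ne X by blast
  let ?J = "insert (f x) {j. bad f t (f x) j}"
  have fin: "finite (profile_partition f t)" unfolding kernel_partition_def by simp
  have "{Y \<in> profile_partition f t. Y = X \<or> \<not> homogeneous E L X Y}
      \<subseteq> (\<Union>j\<in>?J. {Y \<in> profile_partition f t. Y \<subseteq> fibre f j})" (is "?S \<subseteq> ?U")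
  proof
    fix Y assume Y: "Y \<in> ?S"
    then obtain y where y: "y \<in> Y" using ne by blast
    have "f y \<in> ?J"
    proof (cases "Y = X")
      case True
      then show ?thesis using profile_class_subset_fibre[OF X x] y unfolding fibre_def by auto
    next
      case False
      then show ?thesis using homogeneous_profile_classes[OF f X _ x y] Y by auto
    qed
    then show "Y \<in> ?U" using profile_class_subset_fibre[OF _ y] Y by blast
  qed
  then have "card ?S \<le> card ?U" using fin card_bad(1)[OF good] by (intro card_mono) auto
  also have "\<dots> \<le> card ?J * (t * (2 ^ t) ^ t)"
    using card_profile_classes_in_fibre[OF good] card_bad(1)[OF good] by (intro card_UN_le_mult) auto
  also have "\<dots> \<le> (t + 1) * (t * (2 ^ t) ^ t)"
    using card_bad[OF good, of "f x"] by (intro mult_le_mono1) (simp add: card_insert_if)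
  finally show ?thesis .
qed

text \<open>Red edges of \<open>Q\<close> project to red edges or loops of the coarse profile
  partition. This explains \<open>degree_bound\<close>: the coarse classes equal or red to the one
  around \<open>X\<close>, times the parts of \<open>Q\<close> in one coarse class, which is covered
  by two fine fibres.\<close>

lemma red_degree_between:
  assumes f: "monotone_map (c \<circ> f)" and good: "\<And>i. good f t (fibre f i)" "\<And>i. good (c \<circ> f) t (fibre (c \<circ> f) i)"
    and two: "\<And>j. \<exists>a b. fibre (c \<circ> f) j \<subseteq> fibre f a \<union> fibre f b"
    and Q: "refines V (profile_partition f t) Q" "refines V Q (profile_partition (c \<circ> f) t)"
    and X: "X \<in> Q"
  shows "red_degree E L Q X \<le> degree_bound t"
proof -
  let ?P = "profile_partition (c \<circ> f) t" and ?M = "t * (2 ^ t) ^ t"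
  have finP: "finite ?P" and finR: "finite (profile_partition f t)" unfolding kernel_partition_def by simp_all
  have finQ: "finite Q" using Q(1) finite_elements[OF finite_V] unfolding refines_def by blast
  obtain X' where X': "X' \<in> ?P" "X \<subseteq> X'" using Q(2) X unfolding refines_def by blast
  let ?G = "{Y' \<in> ?P. Y' = X' \<or> \<not> homogeneous E L X' Y'}"
  have within: "card {Y \<in> Q. Y \<subseteq> Y'} \<le> 2 * ?M" if Y': "Y' \<in> ?P" for Y'
  proof -
    obtain y where y: "y \<in> Y'" using Y' unfolding kernel_partition_def by auto
    obtain a b where ab: "fibre (c \<circ> f) ((c \<circ> f) y) \<subseteq> fibre f a \<union> fibre f b" using two by blast
    have sub: "{Z \<in> profile_partition f t. Z \<subseteq> Y'}
      \<subseteq> {Z \<in> profile_partition f t. Z \<subseteq> fibre f a} \<union> {Z \<in> profile_partition f t. Z \<subseteq> fibre f b}"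
    proof
      fix Z assume Z: "Z \<in> {Z \<in> profile_partition f t. Z \<subseteq> Y'}"
      then obtain z where z: "z \<in> Z" unfolding kernel_partition_def by auto
      then have "z \<in> fibre f a \<union> fibre f b"
        using profile_class_subset_fibre[OF Y' y] ab Z by blast
      then have "f z = a \<or> f z = b" unfolding fibre_def by blast
      then show "Z \<in> {Z \<in> profile_partition f t. Z \<subseteq> fibre f a} \<union> {Z \<in> profile_partition f t. Z \<subseteq> fibre f b}"
        using profile_class_subset_fibre[OF _ z] Z by blast
    qed
    have "card {Y \<in> Q. Y \<subseteq> Y'} \<le> card {Z \<in> profile_partition f t. Z \<subseteq> Y'}"
      by (rule card_parts_within_le[OF finite_V Q(1)])
    also have "\<dots> \<le> card ({Z \<in> profile_partition f t. Z \<subseteq> fibre f a} \<union> {Z \<in> profile_partition f t. Z \<subseteq> fibre f b})"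
      using sub finR by (intro card_mono) auto
    also have "\<dots> \<le> ?M + ?M"
      using card_Un_le card_profile_classes_in_fibre[OF good(1)] by (meson add_mono order_trans)
    finally show ?thesis by simp
  qed
  have "{Y \<in> Q. Y \<noteq> X \<and> \<not> homogeneous E L X Y} \<subseteq> (\<Union>Y'\<in>?G. {Y \<in> Q. Y \<subseteq> Y'})"
  proof
    fix Y assume Y: "Y \<in> {Y \<in> Q. Y \<noteq> X \<and> \<not> homogeneous E L X Y}"
    then obtain Y' where Y': "Y' \<in> ?P" "Y \<subseteq> Y'" using Q(2) unfolding refines_def by blast
    then have "\<not> homogeneous E L X' Y'" using Y homogeneous_mono X' by blast
    then show "Y \<in> (\<Union>Y'\<in>?G. {Y \<in> Q. Y \<subseteq> Y'})" using Y Y' by blast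
  qed
  then have "red_degree E L Q X \<le> card (\<Union>Y'\<in>?G. {Y \<in> Q. Y \<subseteq> Y'})"
    unfolding red_degree_def using finP finQ by (intro card_mono) auto
  also have "\<dots> \<le> card ?G * (2 * ?M)"
    using within finP by (intro card_UN_le_mult) auto
  also have "\<dots> \<le> (t + 1) * ?M * (2 * ?M)"
    using card_red_neighbours[OF f good(2) X'(1)] by (intro mult_le_mono1)
  finally show ?thesis unfolding degree_bound_def .
qed

text \<open>Induction on the number of intervals. Merging two of them gives a division whose profile
  partition is reached by the induction hypothesis and is coarser than that of \<open>f\<close>; the
  splits leading from one to the other obey \<open>red_degree_between\<close>.\<close>

lemma bounded_splits_to_profile_partition:
  assumes merge: "\<And>f m. monotone_map f \<Longrightarrow> f ` V = {..<m} \<Longrightarrow> 2 \<le> m \<Longrightarrow>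
      \<exists>i. Suc i < m \<and> good f t (fibre f i \<union> fibre f (Suc i))"
    and "monotone_map f" "f ` V = {..<Suc m}" "\<And>i. good f t (fibre f i)"
  shows "(bounded_split E L (degree_bound t))\<^sup>*\<^sup>* {V} (profile_partition f t)"
  using assms(2-)
proof (induction m arbitrary: f)
  case 0
  \<comment> \<open>Weakens the bound \<open>t * (2 ^ t) ^ t\<close> on the number of parts,
    available when only one interval is left, to \<open>degree_bound t\<close>.\<close>
  have le: "x \<le> (t + 1) * x * (2 * x)" for x :: nat by (cases x) auto
  have "V \<noteq> {}" using 0 by auto
  then have "partition_on V {V}" by (simp add: partition_on_space)
  then have ref: "refines V (profile_partition f t) {V}"
    using partition_on_kernel[of V "profile f t"] unfolding refines_def
    by (auto simp: kernel_partition_def)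
  have V: "fibre f 0 = V" using 0 unfolding fibre_def by auto
  have "red_degree E L Q X \<le> degree_bound t" if Q: "refines V (profile_partition f t) Q" for Q X
  proof -
    have "partition_on V Q" using Q unfolding refines_def by blast
    then have sub: "Y \<subseteq> V" if "Y \<in> Q" for Y using that partition_onD1 by blast
    have "finite Q" using \<open>partition_on V Q\<close> finite_elements finite_V by blast
    then have "red_degree E L Q X \<le> card {Y \<in> Q. Y \<subseteq> V}"
      unfolding red_degree_def using sub by (intro card_mono) auto
    also have "\<dots> \<le> card {Z \<in> profile_partition f t. Z \<subseteq> fibre f 0}"
      unfolding V by (rule card_parts_within_le[OF finite_V Q])
    also have "\<dots> \<le> t * (2 ^ t) ^ t" by (rule card_profile_classes_in_fibre[OF 0(3)])
    also have "\<dots> \<le> degree_bound t" unfolding degree_bound_def by (rule le)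
    finally show ?thesis .
  qed
  then show ?case
    by (intro mono_rtranclp[rule_format, OF _ refines_by_splits[OF finite_V ref]])
       (auto simp: bounded_split_def)
next
  case (Suc m)
  obtain i where i: "Suc i < Suc (Suc m)" "good f t (fibre f i \<union> fibre f (Suc i))"
    using merge[OF Suc.prems(1,2)] by auto
  \<comment> \<open>Indices beyond the merged pair move down by one, so that the image is again an
    initial segment.\<close>
  define c where "c = (\<lambda>x. if x \<le> i then x else x - 1 :: nat)"
  have fib: "fibre (c \<circ> f) j = (if j < i then fibre f j else if j = i then fibre f i \<union> fibre f (Suc i)
      else fibre f (Suc j))" for j
    unfolding fibre_def c_def by (auto split: if_splits)
  have mono: "monotone_map (c \<circ> f)"
    using Suc.prems(1) unfolding monotone_map_def c_def by fastforce
  have img: "(c \<circ> f) ` V = {..<Suc m}"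
  proof -
    have "c ` {..<Suc (Suc m)} = {..<Suc m}"
    proof (intro equalityI subsetI)
      fix x assume "x \<in> {..<Suc m}"
      then show "x \<in> c ` {..<Suc (Suc m)}"
        by (intro image_eqI[of _ _ "if x \<le> i then x else Suc x"]) (auto simp: c_def)
    qed (use i in \<open>auto simp: c_def\<close>)
    then show ?thesis using Suc.prems(2) by (metis image_comp)
  qed
  have good: "good (c \<circ> f) t (fibre (c \<circ> f) j)" for j
    unfolding fib using Suc.prems(3) i(2) by (auto intro!: good_comp)
  have steps: "(bounded_split E L (degree_bound t))\<^sup>*\<^sup>* {V} (profile_partition (c \<circ> f) t)"
    by (rule Suc.IH[OF mono img good])
  have ref: "refines V (profile_partition f t) (profile_partition (c \<circ> f) t)"
    by (rule refines_kernel_partition) (rule profile_comp)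
  have two: "\<exists>a b. fibre (c \<circ> f) j \<subseteq> fibre f a \<union> fibre f b" for j
    unfolding fib by (auto intro: exI[of _ i] exI[of _ "Suc i"])
  have "(bounded_split E L (degree_bound t))\<^sup>*\<^sup>* (profile_partition (c \<circ> f) t) (profile_partition f t)"
    by (intro mono_rtranclp[rule_format, OF _ refines_by_splits[OF finite_V ref]])
       (auto simp: bounded_split_def intro!: red_degree_between[OF mono Suc.prems(3) good two])
  then show ?case using steps by auto
qed

lemma tww_at_most_if_mergeable:
  assumes merge: "\<And>f m. monotone_map f \<Longrightarrow> f ` V = {..<m} \<Longrightarrow> 2 \<le> m \<Longrightarrow>
      \<exists>i. Suc i < m \<and> good f t (fibre f i \<union> fibre f (Suc i))"
    and t: "1 \<le> t"
  shows "tww_at_most V E L (degree_bound t)"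
proof (cases "V = {}")
  case False
  \<comment> \<open>The rank in the order is injective, so all intervals, and hence all profile
    classes, are singletons: this is the fine end of the chain.\<close>
  define f where "f = (\<lambda>v. card {u \<in> V. (u, v) \<in> L})"
  have less: "f x < f y" if "(x, y) \<in> L" for x y
  proof -
    have "{u \<in> V. (u, x) \<in> L} \<subset> {u \<in> V. (u, y) \<in> L}"
      using that L_trans L_subset L_irrefl by blast
    then show ?thesis unfolding f_def by (simp add: psubset_card_mono)
  qed
  then have inj: "inj_on f V" using L_total by (intro inj_onI) (metis less_irrefl)
  have "f ` V \<subseteq> {..<card V}"
  proof (rule image_subsetI)
    fix v assume "v \<in> V"
    then have "{u \<in> V. (u, v) \<in> L} \<subset> V" using L_irrefl by blast
    then show "f v \<in> {..<card V}" unfolding f_def by (simp add: psubset_card_mono)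
  qed
  moreover have "card (f ` V) = card V" using inj by (rule card_image)
  ultimately have img: "f ` V = {..<card V}" by (simp add: card_subset_eq)
  have mono: "monotone_map f" unfolding monotone_map_def using less by fastforce
  have "good f t (fibre f i)" for i
  proof -
    have "card (fibre f i) \<le> 1"
      using inj unfolding fibre_def by (simp add: card_le_Suc0_iff_eq inj_on_def)
    \<comment> \<open>A singleton has at most one neighbourhood; this is where
      \<open>1 \<le> t\<close> enters.\<close>
    then have "card (outside f {} ` fibre f i) \<le> t"
      using card_image_le[OF finite_fibre, of "outside f {}" f i] t by linarith
    then show ?thesis unfolding good_def by (intro exI[of _ "{}"]) simp
  qed
  moreover obtain m where "card V = Suc m" using False by (metis card_0_eq finite_V not0_implies_Suc)
  ultimately have "(bounded_split E L (degree_bound t))\<^sup>*\<^sup>* {V} (profile_partition f t)"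
    using bounded_splits_to_profile_partition[OF merge mono] img by metis
  moreover have "profile_partition f t = (\<lambda>v. {v}) ` V"
    using inj unfolding kernel_partition_def profile_def by (intro image_cong) (auto dest: inj_onD)
  ultimately show ?thesis using tww_at_most_iff_bounded_splits[OF False] by metis
qed (simp add: tww_at_most_def)

end

section \<open>The runner in rich divisions\<close>

context fin_ordered_graph
begin

text \<open>An element of \<open>S\<close> between \<open>u\<close> and \<open>v\<close> would lie
  in their common fibre, since fibres are intervals.\<close>

lemma sim_cut_same_fibre:
  assumes g: "monotone_map g" and S: "g u \<notin> g ` S" and uv: "g u = g v"
  shows "sim_cut L S u v"
proof -
  have le: "g x \<le> g y" if "ole L x y" for x y
    using that g unfolding ole_def monotone_map_def by auto
  have "g s = g u" if "(ole L u s \<and> ole L s v) \<or> (ole L v s \<and> ole L s u)" for s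
    using that le uv by (metis order_antisym)
  then show ?thesis using S unfolding sim_cut_def by (metis image_eqI)
qed

text \<open>Without such an edge the neighbourhood of \<open>u \<in> A\<close> outside \<open>K\<close> is determined by the part of \<open>u\<close>.\<close>

lemma flip_edge_leaving_rich_fibre:
  assumes C: "cut_flip V E k C" and A: "A \<subseteq> V" "A \<subseteq> fibre g j" and j: "j \<in> K"
    and rich: "k < card (outside g K ` A)"
  shows "\<exists>u\<in>A. \<exists>w\<in>V. g w \<notin> K \<and> (u, w) \<in> one_edges C"
proof (rule ccontr)
  assume none: "\<not> ?thesis"
  obtain P F where P: "partition_on V P" "card P \<le> k"
    and E': "fst C = (let D = {(x, y). x \<noteq> y \<and> (\<exists>(A, B)\<in>F. (x \<in> A \<and> y \<in> B) \<or> (x \<in> B \<and> y \<in> A))}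
         in (E - D) \<union> (D - E))" and F: "F \<subseteq> P \<times> P"
    using C unfolding cut_flip_def by (auto simp: Let_def)
  define D where "D = {(x, y). x \<noteq> y \<and> (\<exists>(A, B)\<in>F. (x \<in> A \<and> y \<in> B) \<or> (x \<in> B \<and> y \<in> A))}"
  have E'D: "fst C = (E - D) \<union> (D - E)" using E' unfolding D_def by (simp add: Let_def)
  have out: "outside g K u = {w \<in> V. (u, w) \<in> D \<and> g w \<notin> K}" if u: "u \<in> A" for u
  proof -
    have "(u, w) \<in> E \<longleftrightarrow> (u, w) \<in> D" if w: "w \<in> V" "g w \<notin> K" for w
    proof -
      have "u \<noteq> w" using A j u w unfolding fibre_def by auto
      then have "(u, w) \<notin> fst C" using none u w unfolding one_edges_def by blast
      then show ?thesis using E'D by blast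
    qed
    then show ?thesis using E_subset unfolding outside_def by blast
  qed
  have same: "outside g K u = outside g K u'" if "u \<in> A" "u' \<in> A" "X \<in> P" "u \<in> X" "u' \<in> X" for u u' X
  proof -
    have "(u, w) \<in> D \<longleftrightarrow> (u', w) \<in> D" if w: "g w \<notin> K" for w
    proof -
      have "u \<noteq> w" "u' \<noteq> w" using A j \<open>u \<in> A\<close> \<open>u' \<in> A\<close> w unfolding fibre_def by auto
      moreover
      have "u \<in> Y \<longleftrightarrow> u' \<in> Y" if "Y \<in> P" for Y
        using partition_on_unique[OF P(1) \<open>X \<in> P\<close> that] \<open>u \<in> X\<close> \<open>u' \<in> X\<close> by blast
      then have "(\<exists>(A, B)\<in>F. (u \<in> A \<and> w \<in> B) \<or> (u \<in> B \<and> w \<in> A)) \<longleftrightarrow>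
          (\<exists>(A, B)\<in>F. (u' \<in> A \<and> w \<in> B) \<or> (u' \<in> B \<and> w \<in> A))"
        using F by (intro bex_cong refl) auto
      ultimately show ?thesis unfolding D_def by simp
    qed
    then show ?thesis unfolding out[OF that(1)] out[OF that(2)] by blast
  qed
  have "outside g K ` A \<subseteq> (\<lambda>X. outside g K (SOME u. u \<in> X \<and> u \<in> A)) ` P"
  proof (rule image_subsetI)
    fix u assume u: "u \<in> A"
    then obtain X where X: "X \<in> P" "u \<in> X" using P(1) A(1) by (metis Union_iff partition_onD1 subsetD)
    then have "(SOME u. u \<in> X \<and> u \<in> A) \<in> X \<and> (SOME u. u \<in> X \<and> u \<in> A) \<in> A"
      using u by (intro someI[of "\<lambda>u. u \<in> X \<and> u \<in> A" u]) blast
    then show "outside g K u \<in> (\<lambda>X. outside g K (SOME u. u \<in> X \<and> u \<in> A)) ` P"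
      using same[OF u _ X(1) X(2)] X(1) by blast
  qed
  then have "card (outside g K ` A) \<le> card P"
    using finite_elements[OF finite_V P(1)] surj_card_le by blast
  then show False using P(2) rich by linarith
qed

text \<open>Only fibres of actual vertices are considered, because an empty fibre is always good. In
  \<open>Suc k\<close>, the \<open>k\<close> accounts for the fibres met by a cut and the extra one
  for the fibre of the runner.\<close>

definition rich :: "('a \<Rightarrow> nat) \<Rightarrow> nat \<Rightarrow> bool" where
  "rich g k \<longleftrightarrow> (\<forall>v\<in>V. \<not> good g (Suc k) (fibre g (g v)))"

lemma rich_card:
  assumes "rich g k" "v \<in> V" "finite K" "card K \<le> Suc k"
  shows "Suc k < card (outside g K ` fibre g (g v))"
  using assms unfolding rich_def good_def by (metis not_le_imp_less)

text \<open>The invariant is that the runner's fibre avoids the cut of the current \<open>C\<close>.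
  Once \<open>C'\<close> is announced, he moves within his fibre by weight 0 and then takes an edge
  of \<open>C\<close> into a fibre avoiding the cut of \<open>C'\<close>, which restores the
  invariant.\<close>

lemma not_ordered_wins_from_if_rich:
  assumes "ordered_wins_from V E L 1 k C v"
    and g: "monotone_map g" "rich g k"
    and "cut_flip V E k C" "v \<in> V" "g v \<notin> g ` snd C"
  shows False
  using assms(1,4-)
proof induction
  case (step C' C v)
  have S': "finite (snd C')" "card (snd C') \<le> k"
    using step.hyps(1) finite_subset[OF _ finite_V] unfolding cut_flip_def by auto
  let ?A = "fibre g (g v)" and ?K = "insert (g v) (g ` snd C')"
  have "card ?K \<le> Suc k"
    using S' card_image_le[of "snd C'" g] by (simp add: card_insert_if)
  then have "k < card (outside g ?K ` ?A)"
    using rich_card[OF g(2) step.prems(2), of ?K] S'(1) by simp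
  then obtain u w where uw: "u \<in> ?A" "w \<in> V" "g w \<notin> ?K" "(u, w) \<in> one_edges C"
    using flip_edge_leaving_rich_fibre[OF step.prems(1), of ?A g "g v" ?K] unfolding fibre_def by auto
  have u: "u \<in> V" "g v = g u" using uw(1) unfolding fibre_def by auto
  have "sim_cut L (snd C) v u" by (rule sim_cut_same_fibre[OF g(1) step.prems(3) u(2)])
  then have "v = u \<or> (v, u) \<in> zero_edges V L C"
    unfolding zero_edges_def using u step.prems(2) by auto
  moreover have "wreach (zero_edges V L C) (one_edges C) 1 u w"
    using wreach.one[OF uw(4) wreach.refl, of _ 0] by simp
  ultimately have reach: "wreach (zero_edges V L C) (one_edges C) 1 v w"
    by (metis wreach.zero)
  have "\<not> oisolated V L C' w"
  proof -
    \<comment> \<open>With no fibre removed there are still at least two neighbourhoods, so the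
      fibre of \<open>w\<close> has a second vertex, joined to \<open>w\<close> by weight 0.\<close>
    have "Suc k < card (outside g {} ` fibre g (g w))"
      using rich_card[OF g(2) uw(2), of "{}"] by simp
    then have "\<not> card (fibre g (g w)) \<le> 1"
      using card_image_le[OF finite_fibre, of "outside g {}" g "g w"] by linarith
    then obtain x where x: "x \<in> fibre g (g w)" "x \<noteq> w"
      by (metis One_nat_def card_le_Suc0_iff_eq finite_fibre)
    then have "sim_cut L (snd C') w x"
      using uw(3) by (intro sim_cut_same_fibre[OF g(1)]) (auto simp: fibre_def)
    then show ?thesis using x uw(2) unfolding oisolated_def zero_edges_def fibre_def by blast
  qed
  then show False using step.IH[rule_format, OF reach] step.hyps(1) uw(2,3) by blast
qed

lemma not_ordered_flipper_wins_if_rich: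
  assumes g: "monotone_map g" "rich g k" and "V \<noteq> {}"
  shows "\<not> ordered_flipper_wins 1 k V E L"
proof
  assume "ordered_flipper_wins 1 k V E L"
  then obtain C where C: "cut_flip V E k C" and win: "\<forall>v\<in>V. oisolated V L C v \<or> ordered_wins_from V E L 1 k C v"
    unfolding ordered_flipper_wins_def by blast
  have S: "finite (snd C)" "card (snd C) \<le> k"
    using C finite_subset[OF _ finite_V] unfolding cut_flip_def by auto
  obtain x where x: "x \<in> V" using assms(3) by blast
  \<comment> \<open>If the cut met every fibre, removing those at most \<open>k\<close> fibres would
    leave only the empty neighbourhood, against richness.\<close>
  have "\<exists>v\<in>V. g v \<notin> g ` snd C"
  proof (rule ccontr)
    assume "\<not> ?thesis"
    then have "outside g (g ` snd C) u = {}" for u using E_subset unfolding outside_def by blast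
    then have "outside g (g ` snd C) ` fibre g (g x) \<subseteq> {{}}" by blast
    then have "card (outside g (g ` snd C) ` fibre g (g x)) \<le> 1"
      using card_mono[of "{{}}" "outside g (g ` snd C) ` fibre g (g x)"] by simp
    moreover have "card (g ` snd C) \<le> Suc k" using S card_image_le[of "snd C" g] by linarith
    ultimately show False using rich_card[OF g(2) x, of "g ` snd C"] finite_imageI[OF S(1), of g] by linarith
  qed
  then obtain v where v: "v \<in> V" "g v \<notin> g ` snd C" by blast
  have "Suc k < card (outside g {} ` fibre g (g v))"
    using rich_card[OF g(2) v(1), of "{}"] by simp
  then have "\<not> card (fibre g (g v)) \<le> 1"
    using card_image_le[OF finite_fibre, of "outside g {}" g "g v"] by linarith
  then obtain y where y: "y \<in> fibre g (g v)" "y \<noteq> v"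
    by (metis One_nat_def card_le_Suc0_iff_eq finite_fibre)
  then have "sim_cut L (snd C) v y"
    using v(2) by (intro sim_cut_same_fibre[OF g(1)]) (auto simp: fibre_def)
  then have "\<not> oisolated V L C v" using y v unfolding oisolated_def zero_edges_def fibre_def by blast
  then show False using win v not_ordered_wins_from_if_rich[OF _ g C v] by blast
qed

text \<open>Goodness of a coarse fibre pulls back along \<open>h\<close>: each coarse index lifts to
  at most three fine ones, whence the factor 3. The coarse fibre contains the fibres
  \<open>2 * j\<close> and \<open>Suc (2 * j)\<close>, whose union would then be good.\<close>

lemma rich_if_stuck:
  assumes f: "monotone_map f" "f ` V = {..<m}" "2 \<le> m"
    and stuck: "\<And>i. Suc i < m \<Longrightarrow> \<not> good f (3 * Suc k) (fibre f i \<union> fibre f (Suc i))"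
  shows "\<exists>g. monotone_map g \<and> rich g k"
proof -
  \<comment> \<open>If \<open>m\<close> is odd, the last fibre joins the last pair, so a fibre of \<open>h\<close> has up to three elements.\<close>
  define h where "h = (\<lambda>i. min (i div 2) (m div 2 - 1))"
  have "monotone_map (h \<circ> f)"
    using f(1) unfolding monotone_map_def h_def by (auto intro!: min.mono div_le_mono)
  moreover have "\<not> good (h \<circ> f) (Suc k) (fibre (h \<circ> f) ((h \<circ> f) v))" if v: "v \<in> V" for v
  proof
    define j where "j = h (f v)"
    have j: "Suc (2 * j) < m" "h (2 * j) = j" "h (Suc (2 * j)) = j"
      using f(3) unfolding j_def h_def by auto
    assume "good (h \<circ> f) (Suc k) (fibre (h \<circ> f) ((h \<circ> f) v))"
    then obtain K where K: "finite K" "card K \<le> Suc k" "card (outside (h \<circ> f) K ` fibre (h \<circ> f) j) \<le> Suc k"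
      unfolding good_def j_def by auto
    have three: "{i. i < m \<and> h i = l} \<subseteq> {2 * l, 2 * l + 1, 2 * l + 2}" for l
    proof
      fix i assume "i \<in> {i. i < m \<and> h i = l}"
      then show "i \<in> {2 * l, 2 * l + 1, 2 * l + 2}"
        unfolding h_def using f(3) by (auto simp: min_def split: if_splits)
    qed
    have three_card: "card {i. i < m \<and> h i = l} \<le> 3" for l
      using card_mono[OF _ three[of l]] by (auto simp: card_insert_if split: if_splits)
    define K' where "K' = (\<Union>l\<in>K. {i. i < m \<and> h i = l})"
    have "card K' \<le> card K * 3" unfolding K'_def using K(1) three_card by (rule card_UN_le_mult)
    then have cK': "card K' \<le> 3 * Suc k" using mult_le_mono1[OF K(2), of 3] by (metis mult.commute order_trans)
    have "outside f K' u = outside (h \<circ> f) K u" for u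
      using f(2) E_subset unfolding outside_def K'_def by fastforce
    moreover have "fibre f (2 * j) \<union> fibre f (Suc (2 * j)) \<subseteq> fibre (h \<circ> f) j"
      using j unfolding fibre_def by auto
    ultimately have "card (outside f K' ` (fibre f (2 * j) \<union> fibre f (Suc (2 * j))))
        \<le> card (outside (h \<circ> f) K ` fibre (h \<circ> f) j)"
      by (intro card_mono) auto
    then have "good f (3 * Suc k) (fibre f (2 * j) \<union> fibre f (Suc (2 * j)))"
      unfolding good_def using K cK' by (intro exI[of _ K']) (auto simp: K'_def)
    then show False using stuck[OF j(1)] by blast
  qed
  ultimately show ?thesis unfolding rich_def by blast
qed

theorem tww_at_most_if_ordered_flipper_wins:
  assumes "ordered_flipper_wins 1 k V E L"
  shows "tww_at_most V E L (degree_bound (3 * Suc k))"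
proof (cases "V = {}")
  case False
  show ?thesis
  proof (rule tww_at_most_if_mergeable)
    fix f m assume f: "monotone_map f" "f ` V = {..<m}" "2 \<le> m"
    show "\<exists>i. Suc i < m \<and> good f (3 * Suc k) (fibre f i \<union> fibre f (Suc i))"
      using rich_if_stuck[OF f, of k] not_ordered_flipper_wins_if_rich[OF _ _ False] assms by blast
  qed simp
qed (simp add: tww_at_most_def)

end

section \<open>Cut-flips from flips\<close>

text \<open>Consecutive weight-0 steps are compressed into one by transitivity, so a path alternates
  between reflexive \<open>Z\<close> steps and at most \<open>n\<close> edges of
  \<open>W\<close>.\<close>

lemma wreach_normal_form:
  assumes "wreach Z W n u v" and trans: "trans (Z\<^sup>=)"
  shows "\<exists>m\<le>n. (u, v) \<in> Z\<^sup>= O (W O Z\<^sup>=) ^^ m"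
  using assms(1)
proof induction
  case (refl n u)
  then show ?case by (intro exI[of _ 0]) auto
next
  case (zero u w n v)
  then obtain m x where m: "m \<le> n" "(w, x) \<in> Z\<^sup>=" "(x, v) \<in> (W O Z\<^sup>=) ^^ m" by blast
  have "(u, x) \<in> Z\<^sup>=" using trans zero.hyps(1) m(2) by (meson UnI1 transD)
  then show ?case using m by blast
next
  case (one u w n v)
  then obtain m where m: "m \<le> n" "(w, v) \<in> Z\<^sup>= O (W O Z\<^sup>=) ^^ m" by blast
  then have "(u, v) \<in> (W O Z\<^sup>=) O (W O Z\<^sup>=) ^^ m" using one.hyps(1) by blast
  then have "(u, v) \<in> (W O Z\<^sup>=) ^^ Suc m" by (simp add: relpow_commute)
  then show ?case using m(1) by (intro exI[of _ "Suc m"]) blast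
qed

lemma mem_flip_rel:
  assumes P: "partition_on V P" and F: "F \<subseteq> P \<times> P" and "X \<in> P" "Y \<in> P" "x \<in> X" "y \<in> Y"
  shows "(x, y) \<in> flip_rel F R \<longleftrightarrow> ((x, y) \<in> R \<longleftrightarrow> (X, Y) \<notin> F)"
proof -
  have "(x, y) \<in> (\<Union>(A, B)\<in>F. A \<times> B) \<longleftrightarrow> (X, Y) \<in> F"
  proof
    assume "(x, y) \<in> (\<Union>(A, B)\<in>F. A \<times> B)"
    then obtain A B where AB: "(A, B) \<in> F" "x \<in> A" "y \<in> B" by blast
    then have "A = X" "B = Y" using partition_on_unique[OF P] F assms(3-) by blast+
    then show "(X, Y) \<in> F" using AB by blast
  qed (use assms in blast)
  then show ?thesis unfolding flip_rel_def Let_def by blast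
qed

lemma gaifman_sym: "(x, y) \<in> gaifman H \<Longrightarrow> (y, x) \<in> gaifman H"
  unfolding gaifman_def by auto

context fin_ordered_graph
begin

lemma sim_cut_sym: "sim_cut L S u v \<Longrightarrow> sim_cut L S v u"
  unfolding sim_cut_def by blast

text \<open>A cut point between \<open>u\<close> and \<open>v\<close> is comparable with
  \<open>w\<close> and therefore lies between \<open>u\<close> and \<open>w\<close> or between
  \<open>w\<close> and \<open>v\<close>.\<close>

lemma sim_cut_trans:
  assumes "S \<subseteq> V" "w \<in> V" "sim_cut L S u w" "sim_cut L S w v"
  shows "sim_cut L S u v"
proof -
  have "ole L s w \<or> ole L w s" if "s \<in> S" for s
    using ole_total[of s w] assms(1,2) that unfolding ole_def by blast
  then show ?thesis using assms(3,4) unfolding sim_cut_def by metis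
qed

lemma trans_zero_edges:
  assumes "snd C \<subseteq> V"
  shows "trans ((zero_edges V L C)\<^sup>=)"
proof (rule transI)
  fix x y z assume "(x, y) \<in> (zero_edges V L C)\<^sup>=" "(y, z) \<in> (zero_edges V L C)\<^sup>="
  then show "(x, z) \<in> (zero_edges V L C)\<^sup>="
    using sim_cut_trans[OF assms, of y x z] unfolding zero_edges_def by auto
qed

text \<open>This relation is kept between the two games. Besides replaying moves, it transfers
  isolation: a vertex with an edge in \<open>C\<close> has one in the Gaifman graph of
  \<open>H\<close>.\<close>

definition simulates :: "nat \<Rightarrow> 'a rel \<times> 'a rel \<Rightarrow> 'a rel \<times> 'a set \<Rightarrow> bool" where
  "simulates k H C \<longleftrightarrow> cut_flip V E k C \<and> zero_edges V L C \<subseteq> gaifman H \<union> gaifman H O gaifman H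
     \<and> one_edges C \<subseteq> gaifman H"

lemma ex_simulated_cut_flip:
  assumes "is_kflip V k (E, L) H"
  shows "\<exists>C. simulates k H C"
proof -
  obtain P EF LF where P: "partition_on V P" "card P \<le> k" and EF: "EF \<subseteq> P \<times> P" and LF: "LF \<subseteq> P \<times> P"
    and H: "H = (flip_rel EF E, flip_rel LF L)"
    using assms unfolding is_kflip_def by auto
  have part: "\<exists>X\<in>P. x \<in> X" if "x \<in> V" for x using P(1) that by (metis Union_iff partition_onD1)
  have sub: "X \<subseteq> V" if "X \<in> P" for X using P(1) that partition_onD1 by blast
  \<comment> \<open>Only pairs flipped in both directions count: \<open>E\<close> is symmetric, so
    if one direction is left unflipped, every edge of \<open>E\<close> between the two parts
    survives in the Gaifman graph.\<close>
  define F where "F = {(A, B) \<in> EF. (B, A) \<in> EF}"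
  define D where "D = {(x, y). x \<noteq> y \<and> (\<exists>(A, B)\<in>F. (x \<in> A \<and> y \<in> B) \<or> (x \<in> B \<and> y \<in> A))}"
  define top where "top = (\<lambda>A. SOME m. m \<in> A \<and> (\<forall>a\<in>A. ole L a m))"
  have top: "top A \<in> A" "\<And>a. a \<in> A \<Longrightarrow> ole L a (top A)" if "A \<in> P" for A
  proof -
    have "\<exists>m. m \<in> A \<and> (\<forall>a\<in>A. ole L a m)"
      using ex_greatest[OF sub[OF that]] partition_onD3[OF P(1)] that by blast
    then have "top A \<in> A \<and> (\<forall>a\<in>A. ole L a (top A))" unfolding top_def by (rule someI_ex)
    then show "top A \<in> A" "\<And>a. a \<in> A \<Longrightarrow> ole L a (top A)" by auto
  qed
  define C where "C = ((E - D) \<union> (D - E), top ` P)"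
  have "finite P" using finite_elements[OF finite_V P(1)] .
  then have "card (top ` P) \<le> k" using P(2) card_image_le order_trans by blast
  moreover have "top ` P \<subseteq> V" using top(1) sub by blast
  moreover have "F \<subseteq> P \<times> P" using EF unfolding F_def by blast
  ultimately have cut: "cut_flip V E k C"
    unfolding cut_flip_def C_def D_def using P by (intro conjI exI[of _ P] exI[of _ F]) (auto simp: Let_def)
  have "(u, v) \<in> gaifman H" if uv: "(u, v) \<in> one_edges C" for u v
  proof -
    have FV: "A \<subseteq> V \<and> B \<subseteq> V" if "(A, B) \<in> F" for A B using that EF sub unfolding F_def by blast
    have ne: "u \<noteq> v" and mem: "(u, v) \<in> (E - D) \<union> (D - E)" using uv unfolding one_edges_def C_def by auto
    then have "u \<in> V" "v \<in> V" using E_subset FV unfolding D_def by blast+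
    then obtain X Y where XY: "X \<in> P" "Y \<in> P" "u \<in> X" "v \<in> Y" using part by metis
    note flip = mem_flip_rel[OF P(1) EF XY, of E] mem_flip_rel[OF P(1) EF XY(2,1,4,3), of E]
    have "(u, v) \<in> flip_rel EF E \<or> (v, u) \<in> flip_rel EF E"
    proof (cases "(X, Y) \<in> F")
      case True
      then have "(u, v) \<in> D" using ne XY unfolding D_def by blast
      then show ?thesis using mem flip True unfolding F_def by blast
    next
      case False
      have "(u, v) \<notin> D"
      proof
        assume "(u, v) \<in> D"
        then obtain A B where AB: "(A, B) \<in> F" "(u \<in> A \<and> v \<in> B) \<or> (u \<in> B \<and> v \<in> A)"
          unfolding D_def by blast
        then have "A \<in> P" "B \<in> P" using EF unfolding F_def by auto
        then have "(A = X \<and> B = Y) \<or> (B = X \<and> A = Y)"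
          using AB(2) partition_on_unique[OF P(1) _ XY(1) _ XY(3)] partition_on_unique[OF P(1) _ XY(2) _ XY(4)] by blast
        then show False using AB(1) False unfolding F_def by blast
      qed
      then have "(u, v) \<in> E" "(v, u) \<in> E" using mem E_sym by blast+
      then show ?thesis using flip False unfolding F_def by blast
    qed
    then show ?thesis using ne H unfolding gaifman_def by auto
  qed
  moreover
  have up: "(u, v) \<in> gaifman H \<union> gaifman H O gaifman H" if uv: "(u, v) \<in> L" and sim: "sim_cut L (snd C) u v" for u v
  proof (cases "(u, v) \<in> gaifman H")
    case False
    obtain A B where AB: "A \<in> P" "B \<in> P" "u \<in> A" "v \<in> B" using part L_subset[OF uv] by metis
    have ne: "u \<noteq> v" using uv L_irrefl by blast
    have flip: "(x, y) \<in> gaifman H" if "X \<in> P" "Y \<in> P" "x \<in> X" "y \<in> Y" "x \<noteq> y"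
       "((x, y) \<in> L \<longleftrightarrow> (X, Y) \<notin> LF) \<or> ((y, x) \<in> L \<longleftrightarrow> (Y, X) \<notin> LF)" for x y X Y
      using mem_flip_rel[OF P(1) LF that(1-4), of L] mem_flip_rel[OF P(1) LF that(2,1,4,3), of L] that(5,6) H
      unfolding gaifman_def by auto
    have AB_LF: "(A, B) \<in> LF" using flip[OF AB ne] False uv by blast
    \<comment> \<open>The largest element \<open>w\<close> of the part of \<open>u\<close> is a cut
      point, so it cannot lie between \<open>u\<close> and \<open>v\<close> and must be above
      \<open>v\<close>. The pair of \<open>u\<close> and \<open>w\<close> survives any flip of
      \<open>A\<close> with itself, as \<open>L\<close> holds in just one direction, and
      \<open>(w, v)\<close> is created by the flip of \<open>(A, B)\<close>.\<close>
    define w where "w = top A"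
    have w: "w \<in> A" "ole L u w" using top[OF AB(1)] AB(3) unfolding w_def by auto
    have "w \<in> snd C" using AB(1) unfolding C_def w_def by auto
    then have "\<not> ole L w v" using sim w(2) ne unfolding sim_cut_def by blast
    then have vw: "(v, w) \<in> L" using ole_total[of w v] w(1) AB sub by blast
    then have uw: "(u, w) \<in> L" using uv L_trans by blast
    have "(u, w) \<in> gaifman H"
      using flip[OF AB(1,1,3) w(1)] uw L_asym[OF uw] L_irrefl by blast
    moreover have "(w, v) \<in> gaifman H"
      using flip[OF AB(1,2) w(1) AB(4)] AB_LF L_asym[OF vw] L_irrefl vw by blast
    ultimately show ?thesis by blast
  qed simp
  have "(u, v) \<in> gaifman H \<union> gaifman H O gaifman H" if uv: "(u, v) \<in> zero_edges V L C" for u v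
  proof -
    have "u \<in> V" "v \<in> V" "u \<noteq> v" "sim_cut L (snd C) u v" using uv unfolding zero_edges_def by auto
    then consider "(u, v) \<in> L" | "(v, u) \<in> L" using L_total by blast
    then show ?thesis
    proof cases
      case 1
      then show ?thesis by (rule up) fact
    next
      case 2
      have "(v, u) \<in> gaifman H \<union> gaifman H O gaifman H"
        by (rule up[OF 2 sim_cut_sym]) fact
      then have "(v, u) \<in> gaifman H \<or> (\<exists>w. (v, w) \<in> gaifman H \<and> (w, u) \<in> gaifman H)" by auto
      then show ?thesis using gaifman_sym[of _ _ H] by (meson UnI1 UnI2 relcompI)
    qed
  qed
  ultimately have "simulates k H C" unfolding simulates_def using cut by (auto simp del: relcomp_unfold)
  then show ?thesis by blast
qed

lemma simulates_reach:
  assumes sim: "simulates k H C" and reach: "wreach (zero_edges V L C) (one_edges C) 1 v v'"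
  shows "(v, v') \<in> (\<Union>i\<in>{..5}. gaifman H ^^ i)"
proof -
  let ?G = "gaifman H"
  define Z where "Z = (zero_edges V L C)\<^sup>="
  have "snd C \<subseteq> V" using sim unfolding simulates_def cut_flip_def by blast
  from wreach_normal_form[OF reach trans_zero_edges[OF this]]
  obtain m where m: "m \<le> 1" "(v, v') \<in> Z O (one_edges C O Z) ^^ m" unfolding Z_def by blast
  have Z: "\<exists>i\<le>2. (x, y) \<in> ?G ^^ i" if xy: "(x, y) \<in> Z" for x y
  proof -
    have "x = y \<or> (x, y) \<in> ?G \<or> (x, y) \<in> ?G O ?G" using xy sim unfolding simulates_def Z_def by blast
    then show ?thesis
    proof (elim disjE)
      assume "x = y" then show ?thesis by (intro exI[of _ 0]) simp
    next
      assume "(x, y) \<in> ?G" then show ?thesis by (intro exI[of _ 1]) simp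
    next
      assume "(x, y) \<in> ?G O ?G" then show ?thesis
        by (intro exI[of _ 2]) (simp add: numeral_2_eq_2 relcomp_unfold)
    qed
  qed
  have W: "(x, y) \<in> ?G ^^ 1" if "(x, y) \<in> one_edges C" for x y
    using that sim unfolding simulates_def by auto
  have "\<exists>i\<le>5. (v, v') \<in> ?G ^^ i"
  proof (cases "m = 0")
    case True
    then have "(v, v') \<in> Z" using m(2) by simp
    then obtain i where "i \<le> 2" "(v, v') \<in> ?G ^^ i" using Z by blast
    then show ?thesis by (intro exI[of _ i]) simp
  next
    case False
    then have "m = 1" using m(1) by simp
    then obtain x y where xy: "(v, x) \<in> Z" "(x, y) \<in> one_edges C" "(y, v') \<in> Z" using m(2) by auto
    obtain i j where i: "i \<le> 2" "(v, x) \<in> ?G ^^ i" and j: "j \<le> 2" "(y, v') \<in> ?G ^^ j" using Z xy by meson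
    have "(v, v') \<in> ?G ^^ i O ?G ^^ 1 O ?G ^^ j" using i(2) W[OF xy(2)] j(2) by blast
    then have "(v, v') \<in> ?G ^^ (i + (1 + j))" by (simp only: relpow_add)
    then show ?thesis using i(1) j(1) by (intro exI[of _ "i + (1 + j)"]) simp
  qed
  then show ?thesis by blast
qed

lemma ordered_wins_from_if_flipper_wins_from:
  assumes "flipper_wins_from V E L 5 k H v" "simulates k H C"
  shows "ordered_wins_from V E L 1 k C v"
  using assms
proof (induction arbitrary: C)
  case (step H' v H)
  obtain C' where C': "simulates k H' C'" using ex_simulated_cut_flip[OF step.hyps(1)] by blast
  show ?case
  proof (rule ordered_wins_from.step)
    show "cut_flip V E k C'" using C' unfolding simulates_def by blast
    show "\<forall>v'. wreach (zero_edges V L C) (one_edges C) 1 v v' \<longrightarrow>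
      oisolated V L C' v' \<or> ordered_wins_from V E L 1 k C' v'"
    proof (intro allI impI)
      fix v' assume "wreach (zero_edges V L C) (one_edges C) 1 v v'"
      then have "gisolated H' v' \<or> ordered_wins_from V E L 1 k C' v'"
        using step.IH simulates_reach[OF step.prems] C' by blast
      moreover have "gisolated H' v' \<Longrightarrow> oisolated V L C' v'"
        using C' unfolding gisolated_def oisolated_def simulates_def by blast
      ultimately show "oisolated V L C' v' \<or> ordered_wins_from V E L 1 k C' v'" by blast
    qed
  qed
qed

theorem ordered_flipper_wins_if_flipper_wins:
  assumes "flipper_wins 5 k V E L"
  shows "ordered_flipper_wins 1 k V E L"
proof (cases "V = {}")
  case True
  have "cut_flip V E k ({}, {})"
    unfolding cut_flip_def using True E_subset by (intro conjI exI[of _ "{}"]) (auto simp: partition_on_def)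
  then show ?thesis using True unfolding ordered_flipper_wins_def by blast
next
  case False
  then obtain v0 where v0: "v0 \<in> V" by blast
  then have "flipper_wins_from V E L 5 k (E, L) v0" using assms unfolding flipper_wins_def by blast
  then obtain H where H: "is_kflip V k (E, L) H"
    "\<forall>v. (v0, v) \<in> (\<Union>i\<in>{..5}. gaifman (E, L) ^^ i) \<longrightarrow> gisolated H v \<or> flipper_wins_from V E L 5 k H v"
    by (cases rule: flipper_wins_from.cases) blast
  obtain C where C: "simulates k H C" using ex_simulated_cut_flip[OF H(1)] by blast
  have "oisolated V L C v \<or> ordered_wins_from V E L 1 k C v" if v: "v \<in> V" for v
  proof -
    \<comment> \<open>The order makes the Gaifman graph of \<open>(E, L)\<close> complete, so the
      first move of the flipper game reaches any vertex, matching the free choice of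
      \<open>v1\<close> in the ordered game.\<close>
    have "v0 = v \<or> (v0, v) \<in> gaifman (E, L)" using L_total[OF v0 v] unfolding gaifman_def by auto
    then have "(v0, v) \<in> gaifman (E, L) ^^ 0 \<or> (v0, v) \<in> gaifman (E, L) ^^ 1" by simp
    moreover have "0 \<in> {..5::nat}" "1 \<in> {..5::nat}" by auto
    ultimately have "(v0, v) \<in> (\<Union>i\<in>{..5}. gaifman (E, L) ^^ i)" by blast
    then have "gisolated H v \<or> flipper_wins_from V E L 5 k H v" using H(2) by blast
    moreover have "gisolated H v \<Longrightarrow> oisolated V L C v"
      using C unfolding gisolated_def oisolated_def simulates_def by blast
    ultimately show ?thesis using ordered_wins_from_if_flipper_wins_from[OF _ C] by blast
  qed
  then show ?thesis using C unfolding ordered_flipper_wins_def simulates_def by blast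
qed

end

section \<open>The flipper on uncontraction sequences\<close>

lemma relpow_mono:
  fixes R S :: "'a rel"
  assumes "R \<subseteq> S" "(x, y) \<in> R ^^ n"
  shows "(x, y) \<in> S ^^ n"
  using assms(2)
proof (induction n arbitrary: y)
  case (Suc n)
  obtain z where "(x, z) \<in> R ^^ n" "(z, y) \<in> R" using Suc.prems by auto
  then show ?case using Suc.IH assms(1) by auto
qed simp

text \<open>\<open>2 * n\<close> bounds the cut points, two ends for each of \<open>n\<close> parts;
  the remaining summand bounds the number of values of \<open>far_type\<close>.\<close>

definition width_bound :: "nat \<Rightarrow> nat" where
  "width_bound n = 2 * n + (n + 2 ^ n * (2 ^ n * 2 ^ n))"

text \<open>At red degree \<open>d\<close>, a ball of radius \<open>Suc (2 * q)\<close> meets at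
  most \<open>Suc d ^ Suc (2 * q)\<close> parts; the next split adds at most two.\<close>

abbreviation tww_width :: "nat \<Rightarrow> nat \<Rightarrow> nat" where
  "tww_width q d \<equiv> width_bound (Suc d ^ Suc (2 * q) + 2)"

context fin_ordered_graph
begin

text \<open>The red graph, made reflexive and lifted from parts to vertices.\<close>

definition near :: "'a set set \<Rightarrow> 'a rel" where
  "near P = {(u, v). \<exists>X\<in>P. \<exists>Y\<in>P. u \<in> X \<and> v \<in> Y \<and> (X = Y \<or> \<not> homogeneous E L X Y)}"

lemma nearI: "X \<in> P \<Longrightarrow> Y \<in> P \<Longrightarrow> u \<in> X \<Longrightarrow> v \<in> Y \<Longrightarrow> X = Y \<or> \<not> homogeneous E L X Y \<Longrightarrow> (u, v) \<in> near P"
  unfolding near_def by blast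

lemma near_sym: "(u, v) \<in> near P \<Longrightarrow> (v, u) \<in> near P"
  unfolding near_def using homogeneous_sym by blast

lemma near_iff:
  assumes "partition_on V P" "X \<in> P" "Y \<in> P" "u \<in> X" "v \<in> Y"
  shows "(u, v) \<in> near P \<longleftrightarrow> X = Y \<or> \<not> homogeneous E L X Y"
proof
  assume "(u, v) \<in> near P"
  then obtain X' Y' where "X' \<in> P" "Y' \<in> P" "u \<in> X'" "v \<in> Y'" "X' = Y' \<or> \<not> homogeneous E L X' Y'"
    unfolding near_def by blast
  moreover have "X' = X" "Y' = Y" using partition_on_unique[OF assms(1)] assms calculation by blast+
  ultimately show "X = Y \<or> \<not> homogeneous E L X Y" by blast
qed (use assms nearI in blast)

lemma near_subset: "partition_on V P \<Longrightarrow> (u, v) \<in> near P \<Longrightarrow> u \<in> V \<and> v \<in> V"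
  unfolding near_def using partition_onD1 by blast

lemma near_refl: "partition_on V P \<Longrightarrow> v \<in> V \<Longrightarrow> (v, v) \<in> near P"
  by (metis Union_iff nearI partition_onD1)

text \<open>Subsets of homogeneous sets are homogeneous, so balls only shrink as the partition is
  refined.\<close>

lemma near_mono:
  assumes "refines V P' P"
  shows "near P' \<subseteq> near P"
proof
  fix e assume "e \<in> near P'"
  then obtain u v X Y where e: "e = (u, v)" "X \<in> P'" "Y \<in> P'" "u \<in> X" "v \<in> Y" "X = Y \<or> \<not> homogeneous E L X Y"
    unfolding near_def by blast
  have sub: "\<exists>X'\<in>P. X \<subseteq> X'" if "X \<in> P'" for X using that assms unfolding refines_def by blast
  obtain X' Y' where XY: "X' \<in> P" "X \<subseteq> X'" "Y' \<in> P" "Y \<subseteq> Y'" using sub[OF e(2)] sub[OF e(3)] by blast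
  have P: "partition_on V P" using assms unfolding refines_def by blast
  have "X' = Y' \<or> \<not> homogeneous E L X' Y'"
    using e(6)
  proof
    assume "X = Y"
    then show ?thesis using partition_on_unique[OF P XY(1,3)] XY e(4) by blast
  qed (use homogeneous_mono XY in blast)
  then show "e \<in> near P" using nearI[OF XY(1,3)] XY e by blast
qed

lemma near_relpow_subset: "partition_on V P \<Longrightarrow> v \<in> V \<Longrightarrow> (v, w) \<in> near P ^^ i \<Longrightarrow> w \<in> V"
  using near_subset by (cases i) auto

lemma near_relpow_pad:
  assumes "partition_on V P" "v \<in> V" "(v, w) \<in> near P ^^ i" "i \<le> j"
  shows "(v, w) \<in> near P ^^ j"
  using assms(4)
proof (induction j rule: dec_induct)
  case (step n)
  then show ?case using near_refl[OF assms(1) near_relpow_subset[OF assms(1-3)]] by auto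
qed (rule assms(3))

lemma near_singletons: "(u, v) \<in> near ((\<lambda>v. {v}) ` V) \<Longrightarrow> u = v"
  unfolding near_def homogeneous_def using L_total by blast

section \<open>Balls in the red graph\<close>

definition saturated :: "'a set set \<Rightarrow> 'a set \<Rightarrow> bool" where
  "saturated P B \<longleftrightarrow> (\<forall>X\<in>P. X \<subseteq> B \<or> X \<inter> B = {})"

text \<open>The last step of a path may end at any other vertex of the same part. This needs a
  positive radius, as the ball of radius 0 is just \<open>{v}\<close>.\<close>

lemma saturated_ball:
  assumes "partition_on V P"
  shows "saturated P ((near P ^^ Suc s) `` {v})"
proof -
  have "y \<in> (near P ^^ Suc s) `` {v}" if X: "X \<in> P" "x \<in> X" "y \<in> X" "x \<in> (near P ^^ Suc s) `` {v}" for X x y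
  proof -
    obtain z where z: "(v, z) \<in> near P ^^ s" "(z, x) \<in> near P" using X(4) by auto
    obtain Z where Z: "Z \<in> P" "z \<in> Z" using z(2) unfolding near_def by blast
    have "(z, y) \<in> near P"
      using z(2) near_iff[OF assms Z(1) X(1) Z(2) X(2)] near_iff[OF assms Z(1) X(1) Z(2) X(3)] by blast
    then show ?thesis using z(1) by auto
  qed
  then show ?thesis unfolding saturated_def by blast
qed

lemma saturated_refines:
  assumes "saturated P B" "refines V P' P"
  shows "saturated P' B"
  unfolding saturated_def
proof
  fix X assume "X \<in> P'"
  then obtain Y where "Y \<in> P" "X \<subseteq> Y" using assms(2) unfolding refines_def by blast
  moreover have "Y \<subseteq> B \<or> Y \<inter> B = {}" using assms(1) \<open>Y \<in> P\<close> unfolding saturated_def by blast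
  ultimately show "X \<subseteq> B \<or> X \<inter> B = {}" by blast
qed

text \<open>One step multiplies the number of parts by at most \<open>Suc d\<close>: each part stays
  and contributes at most \<open>d\<close> red neighbours.\<close>

lemma card_parts_meeting_ball:
  assumes P: "partition_on V P" and deg: "\<forall>X\<in>P. red_degree E L P X \<le> d"
  shows "card {X \<in> P. X \<inter> (near P ^^ s) `` {v} \<noteq> {}} \<le> Suc d ^ s"
proof (induction s)
  case 0
  have "is_singleton {X \<in> P. v \<in> X} \<or> {X \<in> P. v \<in> X} = {}"
    using partition_on_unique[OF P] by (metis (no_types, lifting) is_singletonI' mem_Collect_eq)
  then have "card {X \<in> P. v \<in> X} \<le> 1" by (metis card.empty is_singleton_altdef le_numeral_extra(4) zero_le)
  then show ?case by simp
next
  case (Suc s)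
  let ?N = "{X \<in> P. X \<inter> (near P ^^ s) `` {v} \<noteq> {}}"
  have fin: "finite P" using finite_elements[OF finite_V P] .
  have "{X \<in> P. X \<inter> (near P ^^ Suc s) `` {v} \<noteq> {}} \<subseteq> (\<Union>X\<in>?N. insert X {Y \<in> P. Y \<noteq> X \<and> \<not> homogeneous E L X Y})"
    (is "?A \<subseteq> ?B")
  proof
    fix Y assume "Y \<in> ?A"
    then obtain x y where Y: "Y \<in> P" "y \<in> Y" "(v, x) \<in> near P ^^ s" "(x, y) \<in> near P" by auto
    then obtain X where X: "X \<in> P" "x \<in> X" unfolding near_def by blast
    then have "X = Y \<or> \<not> homogeneous E L X Y" using near_iff[OF P] Y by blast
    then show "Y \<in> ?B" using X Y by blast
  qed
  then have "card ?A \<le> card ?B" using fin by (intro card_mono) auto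
  also have "\<dots> \<le> card ?N * Suc d"
  proof (rule card_UN_le_mult)
    show "finite ?N" using fin by simp
    fix X assume "X \<in> ?N"
    then have "card {Y \<in> P. Y \<noteq> X \<and> \<not> homogeneous E L X Y} \<le> d" using deg unfolding red_degree_def by blast
    then show "card (insert X {Y \<in> P. Y \<noteq> X \<and> \<not> homogeneous E L X Y}) \<le> Suc d"
      using card_insert_le_m1[of "Suc d"] by simp
  qed
  also have "\<dots> \<le> Suc d ^ Suc s" using Suc mult_le_mono1 by (simp add: mult.commute del: mult_Suc mult_Suc_right)
  finally show ?case .
qed

text \<open>These are the pairs that the flip deletes. They run between homogeneous parts, so if
  \<open>B\<close> is saturated, they form a union of products of parts.\<close>

definition far :: "'a set set \<Rightarrow> 'a set \<Rightarrow> 'a rel \<Rightarrow> 'a rel" where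
  "far P B R = {(x, y) \<in> R. (x, y) \<notin> near P \<and> (x \<in> B \<or> y \<in> B)}"

lemma far_saturated:
  assumes P: "partition_on V P" "saturated P B" and XY: "X \<in> P" "Y \<in> P" "x \<in> X" "y \<in> Y" "x' \<in> X" "y' \<in> Y"
  shows "(x, y) \<in> far P B E \<longleftrightarrow> (x', y') \<in> far P B E"
    and "(x, y) \<in> far P B L \<longleftrightarrow> (x', y') \<in> far P B L"
proof -
  have near: "(x, y) \<in> near P \<longleftrightarrow> X = Y \<or> \<not> homogeneous E L X Y"
     "(x', y') \<in> near P \<longleftrightarrow> X = Y \<or> \<not> homogeneous E L X Y"
    using near_iff[OF P(1) XY(1,2)] XY(3-) by blast+
  have B: "x \<in> B \<longleftrightarrow> x' \<in> B" "y \<in> B \<longleftrightarrow> y' \<in> B" using P(2) XY unfolding saturated_def by blast+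
  have "((x, y) \<in> E \<longleftrightarrow> (x', y') \<in> E)" "((x, y) \<in> L \<longleftrightarrow> (x', y') \<in> L)" if "homogeneous E L X Y"
    using that XY(3-) L_asym unfolding homogeneous_def by blast+
  then show "(x, y) \<in> far P B E \<longleftrightarrow> (x', y') \<in> far P B E" "(x, y) \<in> far P B L \<longleftrightarrow> (x', y') \<in> far P B L"
    using near B unfolding far_def by blast+
qed

lemma far_E_sym: "(x, y) \<in> far P B E \<Longrightarrow> (y, x) \<in> far P B E"
  unfolding far_def using near_sym E_sym by blast

text \<open>The classes of this map serve as the parts of the flip. Both directions of
  \<open>L\<close> are recorded, whereas \<open>E\<close> is symmetric.\<close>

definition far_type :: "'a set set \<Rightarrow> 'a set \<Rightarrow> 'a \<Rightarrow> 'a set \<times> 'a set \<times> 'a set" where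
  "far_type P B u = (far P B E `` {u}, far P B L `` {u}, (far P B L)\<inverse> `` {u})"

text \<open>Inside \<open>B\<close> the type depends only on the part, one of at most
  \<open>n\<close>. For \<open>u\<close> outside \<open>B\<close> each of the three components lies
  in \<open>B\<close> and is a union of parts meeting \<open>B\<close>, giving at most
  \<open>2 ^ n\<close> possibilities apiece.\<close>

lemma card_far_types:
  assumes P: "partition_on V P" "saturated P B" and n: "card {X \<in> P. X \<inter> B \<noteq> {}} \<le> n"
  shows "card (far_type P B ` V) \<le> n + 2 ^ n * (2 ^ n * 2 ^ n)"
proof -
  let ?N = "{X \<in> P. X \<inter> B \<noteq> {}}"
  have fin: "finite ?N" using finite_elements[OF finite_V P(1)] by simp
  let ?U = "Union ` Pow ?N"
  have cU: "card ?U \<le> 2 ^ n" "finite ?U"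
  proof -
    have "card ?U \<le> card (Pow ?N)" using fin by (intro card_image_le) simp
    also have "\<dots> = 2 ^ card ?N" using fin by (simp add: card_Pow)
    also have "\<dots> \<le> 2 ^ n" using n by simp
    finally show "card ?U \<le> 2 ^ n" "finite ?U" using fin by simp_all
  qed
  have same: "far_type P B x = far_type P B x'" if "X \<in> P" "x \<in> X" "x' \<in> X" for X x x'
  proof -
    have part: "\<exists>Y\<in>P. y \<in> Y" if "y \<in> V" for y using P(1) that by (metis Union_iff partition_onD1)
    have V: "y \<in> V" "z \<in> V" if "(y, z) \<in> far P B E \<or> (y, z) \<in> far P B L" for y z
      using that E_subset L_subset unfolding far_def by auto
    have "(x, y) \<in> far P B E \<longleftrightarrow> (x', y) \<in> far P B E" "(x, y) \<in> far P B L \<longleftrightarrow> (x', y) \<in> far P B L"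
      "(y, x) \<in> far P B L \<longleftrightarrow> (y, x') \<in> far P B L" for y
    proof (atomize(full), cases "y \<in> V")
      case False
      then show "((x, y) \<in> far P B E \<longleftrightarrow> (x', y) \<in> far P B E) \<and> ((x, y) \<in> far P B L \<longleftrightarrow> (x', y) \<in> far P B L)
        \<and> ((y, x) \<in> far P B L \<longleftrightarrow> (y, x') \<in> far P B L)" using V by blast
    next
      case y: True
      obtain Y where Y: "Y \<in> P" "y \<in> Y" using part y by blast
      show "((x, y) \<in> far P B E \<longleftrightarrow> (x', y) \<in> far P B E) \<and> ((x, y) \<in> far P B L \<longleftrightarrow> (x', y) \<in> far P B L)
        \<and> ((y, x) \<in> far P B L \<longleftrightarrow> (y, x') \<in> far P B L)"
        using far_saturated[OF P \<open>X \<in> P\<close> Y(1) \<open>x \<in> X\<close> Y(2) \<open>x' \<in> X\<close> Y(2)]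
          far_saturated(2)[OF P Y(1) \<open>X \<in> P\<close> Y(2) \<open>x \<in> X\<close> Y(2) \<open>x' \<in> X\<close>] by blast
    qed
    then show ?thesis unfolding far_type_def by (simp add: Image_singleton)
  qed
  have "far_type P B ` V \<subseteq> (\<lambda>X. far_type P B (SOME x. x \<in> X)) ` ?N \<union> ?U \<times> (?U \<times> ?U)"
  proof (rule image_subsetI)
    fix u assume u: "u \<in> V"
    then obtain X where X: "X \<in> P" "u \<in> X" using P(1) by (metis Union_iff partition_onD1)
    show "far_type P B u \<in> (\<lambda>X. far_type P B (SOME x. x \<in> X)) ` ?N \<union> ?U \<times> (?U \<times> ?U)"
    proof (cases "u \<in> B")
      case True
      have "far_type P B u = far_type P B (SOME x. x \<in> X)"
        using same[OF X] someI[of "\<lambda>x. x \<in> X", OF X(2)] by blast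
      then show ?thesis using True X by blast
    next
      case False
      have U: "W \<in> ?U" if W: "W \<subseteq> B" "W \<subseteq> V" "\<And>Y y y'. Y \<in> P \<Longrightarrow> y \<in> Y \<Longrightarrow> y' \<in> Y \<Longrightarrow> y \<in> W \<Longrightarrow> y' \<in> W" for W
      proof (rule image_eqI)
        show "W = \<Union>{Y \<in> P. Y \<inter> W \<noteq> {}}"
        proof
          show "W \<subseteq> \<Union>{Y \<in> P. Y \<inter> W \<noteq> {}}"
            using W(2) partition_onD1[OF P(1)] by blast
          show "\<Union>{Y \<in> P. Y \<inter> W \<noteq> {}} \<subseteq> W" using W(3) by blast
        qed
        show "{Y \<in> P. Y \<inter> W \<noteq> {}} \<in> Pow ?N" using W(1) by blast
      qed
      have "far P B E `` {u} \<in> ?U"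
      proof (rule U)
        show "far P B E `` {u} \<subseteq> B" using False unfolding far_def by auto
        show "far P B E `` {u} \<subseteq> V" using E_subset unfolding far_def by auto
      qed (use far_saturated(1)[OF P X(1) _ X(2) _ X(2)] in blast)
      moreover have "far P B L `` {u} \<in> ?U"
      proof (rule U)
        show "far P B L `` {u} \<subseteq> B" using False unfolding far_def by auto
        show "far P B L `` {u} \<subseteq> V" using L_subset unfolding far_def by auto
      qed (use far_saturated(2)[OF P X(1) _ X(2) _ X(2)] in blast)
      moreover have "(far P B L)\<inverse> `` {u} \<in> ?U"
      proof (rule U)
        show "(far P B L)\<inverse> `` {u} \<subseteq> B" using False unfolding far_def by auto
        show "(far P B L)\<inverse> `` {u} \<subseteq> V" using L_subset unfolding far_def by auto
      qed (use far_saturated(2)[OF P _ X(1) _ X(2) _ X(2)] in blast)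
      ultimately show ?thesis unfolding far_type_def by blast
    qed
  qed
  then have "card (far_type P B ` V) \<le> card ((\<lambda>X. far_type P B (SOME x. x \<in> X)) ` ?N \<union> ?U \<times> (?U \<times> ?U))"
    using fin cU(2) by (intro card_mono finite_UnI finite_imageI finite_cartesian_product) auto
  also have "\<dots> \<le> card ((\<lambda>X. far_type P B (SOME x. x \<in> X)) ` ?N) + card (?U \<times> (?U \<times> ?U))"
    by (rule card_Un_le)
  also have "\<dots> \<le> n + 2 ^ n * (2 ^ n * 2 ^ n)"
    using card_image_le[OF fin, of "\<lambda>X. far_type P B (SOME x. x \<in> X)"] n cU(1)
    unfolding card_cartesian_product by (intro add_mono mult_le_mono) linarith+
  finally show ?thesis .
qed

definition clear_ball :: "'a set set \<Rightarrow> 'a set \<Rightarrow> 'a rel \<times> 'a rel" where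
  "clear_ball P B = (E - far P B E, L - far P B L)"

definition cut_ball :: "'a set set \<Rightarrow> 'a set \<Rightarrow> 'a rel \<times> 'a set" where
  "cut_ball P B = (E - far P B E,
     {m. \<exists>X\<in>P. X \<inter> B \<noteq> {} \<and> m \<in> X \<and> ((\<forall>a\<in>X. ole L a m) \<or> (\<forall>a\<in>X. ole L m a))})"

text \<open>Whether a pair is far depends only on the types of its two ends, so deleting the far
  pairs is a flip with respect to the type classes.\<close>

lemma far_rectangles:
  fixes P B
  defines "Q \<equiv> kernel_partition V (far_type P B)"
  assumes R: "R = E \<or> R = L"
  shows "(\<Union>(A, A')\<in>{(A, A') \<in> Q \<times> Q. \<exists>a\<in>A. \<exists>a'\<in>A'. (a, a') \<in> far P B R}. A \<times> A') = far P B R"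
proof -
  have E: "(x, y) \<in> far P B E \<longleftrightarrow> (x', y) \<in> far P B E" if "far_type P B x = far_type P B x'" for x x' y
    using that unfolding far_type_def by blast
  have L: "(x, y) \<in> far P B L \<longleftrightarrow> (x', y) \<in> far P B L" "(y, x) \<in> far P B L \<longleftrightarrow> (y, x') \<in> far P B L"
    if "far_type P B x = far_type P B x'" for x x' y
    using that unfolding far_type_def by blast+
  have inv: "(x, y) \<in> far P B R \<longleftrightarrow> (x', y') \<in> far P B R"
    if "far_type P B x = far_type P B x'" "far_type P B y = far_type P B y'" for x y x' y'
    using R
  proof
    assume "R = E"
    then show ?thesis using E[OF that(1)] E[OF that(2)] far_E_sym by metis
  next
    assume "R = L"
    then show ?thesis using L[OF that(1)] L[OF that(2)] by metis
  qed
  have cls: "far_type P B a = far_type P B b" if "A \<in> Q" "a \<in> A" "b \<in> A" for A a b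
    using that unfolding Q_def kernel_partition_def by force
  have ex: "\<exists>A\<in>Q. a \<in> A" if "a \<in> V" for a
    using that partition_onD1[OF partition_on_kernel[of V "far_type P B"]] unfolding Q_def by blast
  have V: "a \<in> V \<and> b \<in> V" if "(a, b) \<in> far P B R" for a b
    using that R E_subset L_subset unfolding far_def by blast
  show ?thesis
  proof
    show "far P B R \<subseteq> (\<Union>(A, A')\<in>{(A, A') \<in> Q \<times> Q. \<exists>a\<in>A. \<exists>a'\<in>A'. (a, a') \<in> far P B R}. A \<times> A')"
    proof (rule subrelI)
      fix a b assume ab: "(a, b) \<in> far P B R"
      then obtain A A' where "A \<in> Q" "A' \<in> Q" "a \<in> A" "b \<in> A'" using ex V by meson
      then show "(a, b) \<in> (\<Union>(A, A')\<in>{(A, A') \<in> Q \<times> Q. \<exists>a\<in>A. \<exists>a'\<in>A'. (a, a') \<in> far P B R}. A \<times> A')"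
        using ab by blast
    qed
    show "(\<Union>(A, A')\<in>{(A, A') \<in> Q \<times> Q. \<exists>a\<in>A. \<exists>a'\<in>A'. (a, a') \<in> far P B R}. A \<times> A') \<subseteq> far P B R"
    proof clarify
      fix A A' x y a a' assume "A \<in> Q" "A' \<in> Q" "x \<in> A" "y \<in> A'" "a \<in> A" "a' \<in> A'" "(a, a') \<in> far P B R"
      then show "(x, y) \<in> far P B R" using inv[of x a y a'] cls by blast
    qed
  qed
qed

lemma is_kflip_clear_ball:
  assumes P: "partition_on V P" "saturated P B" and n: "card {X \<in> P. X \<inter> B \<noteq> {}} \<le> n"
  shows "is_kflip V (width_bound n) (E, L) (clear_ball P B)"
proof -
  define Q where "Q = kernel_partition V (far_type P B)"
  define F where "F = (\<lambda>R. {(A, A') \<in> Q \<times> Q. \<exists>a\<in>A. \<exists>a'\<in>A'. (a, a') \<in> far P B R})"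
  have "flip_rel (F R) R = R - far P B R" if "R = E \<or> R = L" for R
    using far_rectangles[OF that, of P B] unfolding flip_rel_def F_def Q_def Let_def by (auto simp: far_def)
  then have "clear_ball P B = (flip_rel (F E) E, flip_rel (F L) L)" unfolding clear_ball_def by simp
  moreover have "F R \<subseteq> Q \<times> Q" for R unfolding F_def by blast
  moreover have "partition_on V Q" unfolding Q_def by (rule partition_on_kernel)
  moreover have "card Q \<le> width_bound n"
    using card_far_types[OF P n] unfolding Q_def card_kernel_partition[OF finite_V] width_bound_def by linarith
  ultimately show ?thesis unfolding is_kflip_def by (metis fst_conv snd_conv)
qed

lemma cut_flip_cut_ball:
  assumes P: "partition_on V P" "saturated P B" and n: "card {X \<in> P. X \<inter> B \<noteq> {}} \<le> n"
  shows "cut_flip V E (width_bound n) (cut_ball P B)"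
proof -
  let ?Q = "kernel_partition V (far_type P B)" and ?N = "{X \<in> P. X \<inter> B \<noteq> {}}"
  let ?F = "{(A, A') \<in> ?Q \<times> ?Q. \<exists>a\<in>A. \<exists>a'\<in>A'. (a, a') \<in> far P B E}"
  have fin: "finite ?N" using finite_elements[OF finite_V P(1)] by simp
  have mem: "(x, y) \<in> far P B E \<longleftrightarrow> (\<exists>(A, A')\<in>?F. x \<in> A \<and> y \<in> A')"
    "(y, x) \<in> far P B E \<longleftrightarrow> (\<exists>(A, A')\<in>?F. x \<in> A' \<and> y \<in> A)" for x y
    using far_rectangles[of E P B] by blast+
  have bex_disj: "(\<exists>(A, A')\<in>F. p A A' \<or> p' A A') \<longleftrightarrow> (\<exists>(A, A')\<in>F. p A A') \<or> (\<exists>(A, A')\<in>F. p' A A')"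
    for F :: "('a set \<times> 'a set) set" and p p' by blast
  \<comment> \<open>A cut-flip inverts adjacency in both directions at once; this adds no pairs here
    because the far pairs of \<open>E\<close> are symmetric.\<close>
  have "{(x, y). x \<noteq> y \<and> (\<exists>(A, A')\<in>?F. (x \<in> A \<and> y \<in> A') \<or> (x \<in> A' \<and> y \<in> A))} = far P B E"
  proof -
    have "(\<exists>(A, A')\<in>?F. (x \<in> A \<and> y \<in> A') \<or> (x \<in> A' \<and> y \<in> A)) \<longleftrightarrow> (x, y) \<in> far P B E \<or> (y, x) \<in> far P B E" for x y
      unfolding bex_disj using mem[of x y] mem(2)[of y x] by argo
    moreover have "(x, x) \<notin> far P B E" for x unfolding far_def by simp
    ultimately show ?thesis using far_E_sym by auto
  qed
  moreover have "(E - far P B E) \<union> (far P B E - E) = E - far P B E" unfolding far_def by blast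
  moreover have "card ?Q \<le> width_bound n"
    using card_far_types[OF P n] unfolding card_kernel_partition[OF finite_V] width_bound_def by linarith
  moreover have "snd (cut_ball P B) \<subseteq> V"
    using partition_onD1[OF P(1)] unfolding cut_ball_def by auto
  moreover have "card (snd (cut_ball P B)) \<le> width_bound n"
  proof -
    let ?M = "\<lambda>X. {m \<in> X. (\<forall>a\<in>X. ole L a m)} \<union> {m \<in> X. (\<forall>a\<in>X. ole L m a)}"
    have anti: "a = b" if "ole L a b" "ole L b a" for a b using that L_asym unfolding ole_def by blast
    have one: "card {m \<in> X. (\<forall>a\<in>X. ole L a m)} \<le> 1" "card {m \<in> X. (\<forall>a\<in>X. ole L m a)} \<le> 1" if "X \<in> P" for X
    proof -
      have "finite X" using that P(1) finite_V partition_onD1 by (metis Union_upper finite_subset)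
      then show "card {m \<in> X. (\<forall>a\<in>X. ole L a m)} \<le> 1" "card {m \<in> X. (\<forall>a\<in>X. ole L m a)} \<le> 1"
        using anti by (auto simp: card_le_Suc0_iff_eq)
    qed
    have "snd (cut_ball P B) = (\<Union>X\<in>?N. ?M X)" unfolding cut_ball_def by auto
    moreover have "card (?M X) \<le> 2" if "X \<in> ?N" for X
      using card_Un_le[of "{m \<in> X. (\<forall>a\<in>X. ole L a m)}" "{m \<in> X. (\<forall>a\<in>X. ole L m a)}"] one[of X] that by simp
    ultimately have "card (snd (cut_ball P B)) \<le> card ?N * 2"
      using card_UN_le_mult[OF fin, of ?M 2] by simp
    then show ?thesis using n unfolding width_bound_def by linarith
  qed
  ultimately show ?thesis
    unfolding cut_flip_def
    by (intro conjI exI[of _ ?Q] exI[of _ ?F]) (auto simp: Let_def partition_on_kernel cut_ball_def)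
qed

lemma near_if_gaifman_clear_ball:
  assumes "(x, y) \<in> gaifman (clear_ball P B)" "x \<in> B"
  shows "(x, y) \<in> near P"
  using assms near_sym unfolding gaifman_def clear_ball_def far_def by auto

lemma near_if_one_edges_cut_ball:
  assumes "(x, y) \<in> one_edges (cut_ball P B)" "x \<in> B"
  shows "(x, y) \<in> near P"
  using assms unfolding one_edges_def cut_ball_def far_def by auto

text \<open>Both ends of the part \<open>X\<close> of \<open>x\<close> are cut points, so a vertex
  \<open>y\<close> joined to \<open>x\<close> by weight 0 is neither above nor below all of
  \<open>X\<close>. Hence the order between \<open>X\<close> and the part of \<open>y\<close> is not
  constant.\<close>

lemma near_if_zero_edges_cut_ball:
  assumes P: "partition_on V P" and xy: "(x, y) \<in> (zero_edges V L (cut_ball P B))\<^sup>=" "x \<in> B" "x \<in> V"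
  shows "(x, y) \<in> near P"
proof (cases "x = y")
  case False
  then have V: "x \<in> V" "y \<in> V" and sim: "sim_cut L (snd (cut_ball P B)) x y"
    using xy unfolding zero_edges_def by auto
  obtain X Y where XY: "X \<in> P" "Y \<in> P" "x \<in> X" "y \<in> Y" using P V by (metis Union_iff partition_onD1)
  have "X \<subseteq> V" "X \<noteq> {}" using P XY partition_onD1 by blast+
  obtain m where m: "m \<in> X" "\<forall>a\<in>X. ole L a m" using ex_greatest[OF \<open>X \<subseteq> V\<close> \<open>X \<noteq> {}\<close>] by blast
  obtain l where l: "l \<in> X" "\<forall>a\<in>X. ole L l a" using ex_least[OF \<open>X \<subseteq> V\<close> \<open>X \<noteq> {}\<close>] by blast
  have "m \<in> snd (cut_ball P B)" "l \<in> snd (cut_ball P B)"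
    using m l XY(1,3) xy(2) unfolding cut_ball_def by auto
  then have "\<not> (ole L x m \<and> ole L m y)" "\<not> (ole L y l \<and> ole L l x)"
    using sim False unfolding sim_cut_def by blast+
  then have "(m, y) \<notin> L" "(y, l) \<notin> L" using m l XY(3) unfolding ole_def by blast+
  then have "\<not> homogeneous E L X Y" using m(1) l(1) XY(4) unfolding homogeneous_def by blast
  then show ?thesis using nearI[OF XY] by blast
qed (use near_refl[OF P] xy(3) in blast)

text \<open>The runner is at distance at most \<open>q\<close> from \<open>v\<close> and makes at
  most \<open>q\<close> further steps. Before each of them he is within \<open>2 * q\<close> of
  \<open>v\<close> in the old partition, hence in \<open>B\<close>, where only edges along
  \<open>near P'\<close> are left.\<close>

lemma stays_near_in_clear_ball:
  assumes ref: "refines V P' P" and v: "v \<in> V" "(v, v') \<in> near P ^^ q"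
  defines "B \<equiv> (near P ^^ Suc (2 * q)) `` {v}"
  assumes "i \<le> q" "(v', w) \<in> gaifman (clear_ball P' B) ^^ i"
  shows "(v', w) \<in> near P' ^^ i"
  using assms(5-)
proof (induction i arbitrary: w)
  case (Suc i)
  have P: "partition_on V P" using ref unfolding refines_def by blast
  obtain z where z: "(v', z) \<in> gaifman (clear_ball P' B) ^^ i" "(z, w) \<in> gaifman (clear_ball P' B)"
    using Suc.prems(2) by auto
  have near: "(v', z) \<in> near P' ^^ i" using Suc.IH[OF _ z(1)] Suc.prems(1) by simp
  have "(v', z) \<in> near P ^^ i" by (rule relpow_mono[OF near_mono[OF ref] near])
  then have "(v, z) \<in> near P ^^ (q + i)" using v(2) by (auto simp: relpow_add)
  then have "z \<in> B" using near_relpow_pad[OF P v(1), of z "q + i" "Suc (2 * q)"] Suc.prems(1) unfolding B_def by simp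
  then show ?case using near near_if_gaifman_clear_ball[OF z(2)] by auto
qed simp

text \<open>In normal form, \<open>m\<close> edges of weight 1 come with \<open>m + 1\<close>
  segments of weight 0, hence \<open>2 * m + 1\<close> steps of \<open>near\<close>; this is why one
  move is measured by \<open>q = Suc (2 * r)\<close>.\<close>

lemma stays_near_in_cut_ball:
  assumes ref: "refines V P' P" and v: "v \<in> V" "(v, v') \<in> near P ^^ q" and q: "q = Suc (2 * r)"
  defines "B \<equiv> (near P ^^ Suc (2 * q)) `` {v}"
  defines "Z \<equiv> (zero_edges V L (cut_ball P' B))\<^sup>="
  assumes "m \<le> r" "(v', w) \<in> Z O (one_edges (cut_ball P' B) O Z) ^^ m"
  shows "(v', w) \<in> near P' ^^ Suc (2 * m)"
proof -
  have P: "partition_on V P" and P': "partition_on V P'" using ref unfolding refines_def by blast+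
  have v': "v' \<in> V" by (rule near_relpow_subset[OF P v])
  have ball: "z \<in> B \<and> z \<in> V" if "(v', z) \<in> near P' ^^ i" "i \<le> q" for z i
  proof -
    have "(v', z) \<in> near P ^^ i" by (rule relpow_mono[OF near_mono[OF ref] that(1)])
    then have "(v, z) \<in> near P ^^ (q + i)" using v(2) by (auto simp: relpow_add)
    then have "z \<in> B" using near_relpow_pad[OF P v(1), of z "q + i" "Suc (2 * q)"] that(2) unfolding B_def by simp
    then show ?thesis using near_relpow_subset[OF P' v' that(1)] by blast
  qed
  have Z: "(x, y) \<in> near P'" if "(x, y) \<in> Z" "x \<in> B \<and> x \<in> V" for x y
    using near_if_zero_edges_cut_ball[OF P'] that unfolding Z_def by blast
  show ?thesis
    using assms(7-)
  proof (induction m arbitrary: w)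
    case 0
    then have "(v', w) \<in> Z" by simp
    then show ?case using Z ball[of v' 0] by simp
  next
    case (Suc m)
    then obtain x y where xy: "(v', x) \<in> Z O (one_edges (cut_ball P' B) O Z) ^^ m"
      "(x, y) \<in> one_edges (cut_ball P' B)" "(y, w) \<in> Z" by auto
    have x: "(v', x) \<in> near P' ^^ Suc (2 * m)" using Suc.IH[OF _ xy(1)] Suc.prems(1) by simp
    then have "(x, y) \<in> near P'"
      using near_if_one_edges_cut_ball[OF xy(2)] ball[OF x] Suc.prems(1) q by simp
    then have y: "(v', y) \<in> near P' ^^ Suc (Suc (2 * m))" using x by (metis relpow_Suc_I)
    then have "(y, w) \<in> near P'" using Z[OF xy(3)] ball[OF y] Suc.prems(1) q by simp
    then have "(v', w) \<in> near P' ^^ Suc (Suc (Suc (2 * m)))" using y by (metis relpow_Suc_I)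
    then show ?case by simp
  qed
qed

text \<open>
  The flip must be announced before the runner moves, so the ball is taken in the old partition \<open>P\<close>
  and has twice the radius, while the flip refers to the next partition \<open>P'\<close>.
\<close>

lemma ball_properties:
  fixes q :: nat and v :: 'a
  assumes P: "partition_on V P" and deg: "\<forall>X\<in>P. red_degree E L P X \<le> d"
    and P': "P' = P \<or> split_step P P'"
  defines "B \<equiv> (near P ^^ Suc (2 * q)) `` {v}"
  shows "refines V P' P" "saturated P' B" "card {X \<in> P'. X \<inter> B \<noteq> {}} \<le> Suc d ^ Suc (2 * q) + 2"
proof -
  show ref: "refines V P' P" using P' partition_on_split(1)[OF P] refines_refl[OF P] by blast
  show "saturated P' B" unfolding B_def by (rule saturated_refines[OF saturated_ball[OF P] ref])
  have fin: "finite P" using finite_elements[OF finite_V P] .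
  \<comment> \<open>At most two parts are new, and none if \<open>P' = P\<close>, the case used once
    singletons are reached.\<close>
  obtain A A' where AA: "P' \<subseteq> P \<union> {A, A'}" using P' unfolding split_step_def by blast
  have "{X \<in> P'. X \<inter> B \<noteq> {}} \<subseteq> {X \<in> P. X \<inter> B \<noteq> {}} \<union> {A, A'}" using AA by blast
  then have "card {X \<in> P'. X \<inter> B \<noteq> {}} \<le> card ({X \<in> P. X \<inter> B \<noteq> {}} \<union> {A, A'})"
    using fin by (intro card_mono) auto
  also have "\<dots> \<le> card {X \<in> P. X \<inter> B \<noteq> {}} + card {A, A'}" by (rule card_Un_le)
  also have "\<dots> \<le> Suc d ^ Suc (2 * q) + 2"
    using card_parts_meeting_ball[OF P deg, of "Suc (2 * q)" v] unfolding B_def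
    by (intro add_mono) (auto simp: card_insert_if simp del: relpow.simps)
  finally show "card {X \<in> P'. X \<inter> B \<noteq> {}} \<le> Suc d ^ Suc (2 * q) + 2" .
qed

text \<open>Induction along the uncontraction sequence. \<open>H\<close> enters only through the
  invariant that all moves available in it stay within \<open>q\<close> steps of
  \<open>near P\<close>; the flip for the next partition restores the invariant for
  \<open>P'\<close>. At singletons the flip isolates every vertex of the ball.\<close>

lemma flipper_wins_from_partition:
  assumes "(bounded_split E L d)\<^sup>*\<^sup>* P ((\<lambda>v. {v}) ` V)"
    and "partition_on V P" "\<forall>X\<in>P. red_degree E L P X \<le> d" "v \<in> V"
    and "\<And>v'. (v, v') \<in> (\<Union>i\<in>{..q}. gaifman H ^^ i) \<Longrightarrow> (v, v') \<in> near P ^^ q"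
  shows "flipper_wins_from V E L q (tww_width q d) H v"
  using assms
proof (induction arbitrary: H v rule: converse_rtranclp_induct)
  case base
  let ?P = "(\<lambda>v. {v}) ` V"
  define B where "B = (near ?P ^^ Suc (2 * q)) `` {v}"
  note ball = ball_properties(1)[OF base(1,2) disjI1[OF HOL.refl]]
    ball_properties(2,3)[OF base(1,2) disjI1[OF HOL.refl], where q = q and v = v, folded B_def]
  show ?case
  proof (rule flipper_wins_from.step)
    show "is_kflip V (tww_width q d) (E, L) (clear_ball ?P B)"
      using is_kflip_clear_ball[OF base(1) ball(2)] ball(3) by simp
    have "gisolated (clear_ball ?P B) v'" if "(v, v') \<in> (\<Union>i\<in>{..q}. gaifman H ^^ i)" for v'
    proof -
      have "v' \<in> B"
        using near_relpow_pad[OF base(1,3) base(4)[OF that], of "Suc (2 * q)"] unfolding B_def by simp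
      then have "v' = u" if "(v', u) \<in> gaifman (clear_ball ?P B)" for u
        using near_singletons near_if_gaifman_clear_ball[OF that] by blast
      then show ?thesis unfolding gisolated_def gaifman_def by blast
    qed
    then show "\<forall>v'. (v, v') \<in> (\<Union>i\<in>{..q}. gaifman H ^^ i) \<longrightarrow>
      gisolated (clear_ball ?P B) v' \<or> flipper_wins_from V E L q (tww_width q d) (clear_ball ?P B) v'" by blast
  qed
next
  case (step P P')
  have split: "split_step P P'" "\<forall>X\<in>P'. red_degree E L P' X \<le> d"
    using step.hyps(1) unfolding bounded_split_def by auto
  define B where "B = (near P ^^ Suc (2 * q)) `` {v}"
  note ball = ball_properties(1)[OF step.prems(1,2) disjI2[OF split(1)]]
    ball_properties(2,3)[OF step.prems(1,2) disjI2[OF split(1)], where q = q and v = v, folded B_def]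
  have P': "partition_on V P'" using ball(1) unfolding refines_def by blast
  show ?case
  proof (rule flipper_wins_from.step)
    show "is_kflip V (tww_width q d) (E, L) (clear_ball P' B)"
      by (rule is_kflip_clear_ball[OF P' ball(2,3)])
    have "flipper_wins_from V E L q (tww_width q d) (clear_ball P' B) v'"
      if reach: "(v, v') \<in> (\<Union>i\<in>{..q}. gaifman H ^^ i)" for v'
    proof (rule step.IH[OF P' split(2)])
      have near: "(v, v') \<in> near P ^^ q" by (rule step.prems(4)[OF reach])
      show v': "v' \<in> V" by (rule near_relpow_subset[OF step.prems(1,3) near])
      fix w assume "(v', w) \<in> (\<Union>i\<in>{..q}. gaifman (clear_ball P' B) ^^ i)"
      then obtain i where i: "i \<le> q" "(v', w) \<in> gaifman (clear_ball P' B) ^^ i" by blast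
      have "(v', w) \<in> near P' ^^ i"
        using stays_near_in_clear_ball[OF ball(1) step.prems(3) near i(1)] i(2) unfolding B_def by blast
      then show "(v', w) \<in> near P' ^^ q" by (rule near_relpow_pad[OF P' v' _ i(1)])
    qed
    then show "\<forall>v'. (v, v') \<in> (\<Union>i\<in>{..q}. gaifman H ^^ i) \<longrightarrow>
      gisolated (clear_ball P' B) v' \<or> flipper_wins_from V E L q (tww_width q d) (clear_ball P' B) v'" by blast
  qed
qed

text \<open>The same induction for the ordered game; moves are first brought into normal form, so
  that they can be counted in steps of \<open>near\<close>.\<close>

lemma ordered_wins_from_partition:
  assumes "(bounded_split E L d)\<^sup>*\<^sup>* P ((\<lambda>v. {v}) ` V)" and q: "q = Suc (2 * r)"
    and "partition_on V P" "\<forall>X\<in>P. red_degree E L P X \<le> d" "v \<in> V"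
    and "\<And>v'. wreach (zero_edges V L C) (one_edges C) r v v' \<Longrightarrow> (v, v') \<in> near P ^^ q"
  shows "ordered_wins_from V E L r (tww_width q d) C v"
  using assms(1,3-)
proof (induction arbitrary: C v rule: converse_rtranclp_induct)
  case base
  let ?P = "(\<lambda>v. {v}) ` V"
  define B where "B = (near ?P ^^ Suc (2 * q)) `` {v}"
  note ball = ball_properties(1)[OF base(1,2) disjI1[OF HOL.refl]]
    ball_properties(2,3)[OF base(1,2) disjI1[OF HOL.refl], where q = q and v = v, folded B_def]
  show ?case
  proof (rule ordered_wins_from.step)
    show "cut_flip V E (tww_width q d) (cut_ball ?P B)"
      using cut_flip_cut_ball[OF base(1) ball(2)] ball(3) by simp
    have "oisolated V L (cut_ball ?P B) v'" if reach: "wreach (zero_edges V L C) (one_edges C) r v v'" for v'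
    proof -
      have near: "(v, v') \<in> near ?P ^^ q" by (rule base(4)[OF reach])
      have "v' \<in> B"
        using near_relpow_pad[OF base(1,3) near, of "Suc (2 * q)"] unfolding B_def by simp
      moreover have "v' \<in> V" by (rule near_relpow_subset[OF base(1,3) near])
      ultimately have "v' = u" if "(v', u) \<in> zero_edges V L (cut_ball ?P B) \<or> (v', u) \<in> one_edges (cut_ball ?P B)" for u
        using that near_if_zero_edges_cut_ball[OF base(1) UnI1, of v' u B] near_if_one_edges_cut_ball[of v' u ?P B]
          near_singletons[of v' u] by argo
      then show ?thesis unfolding oisolated_def zero_edges_def one_edges_def by blast
    qed
    then show "\<forall>v'. wreach (zero_edges V L C) (one_edges C) r v v' \<longrightarrow>
      oisolated V L (cut_ball ?P B) v' \<or> ordered_wins_from V E L r (tww_width q d) (cut_ball ?P B) v'" by blast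
  qed
next
  case (step P P')
  have split: "split_step P P'" "\<forall>X\<in>P'. red_degree E L P' X \<le> d"
    using step.hyps(1) unfolding bounded_split_def by auto
  define B where "B = (near P ^^ Suc (2 * q)) `` {v}"
  note ball = ball_properties(1)[OF step.prems(1,2) disjI2[OF split(1)]]
    ball_properties(2,3)[OF step.prems(1,2) disjI2[OF split(1)], where q = q and v = v, folded B_def]
  have P': "partition_on V P'" using ball(1) unfolding refines_def by blast
  have cut: "cut_flip V E (tww_width q d) (cut_ball P' B)"
    by (rule cut_flip_cut_ball[OF P' ball(2,3)])
  show ?case
  proof (rule ordered_wins_from.step[OF cut])
    have "ordered_wins_from V E L r (tww_width q d) (cut_ball P' B) v'"
      if reach: "wreach (zero_edges V L C) (one_edges C) r v v'" for v'
    proof (rule step.IH[OF P' split(2)])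
      have near: "(v, v') \<in> near P ^^ q" by (rule step.prems(4)[OF reach])
      show v': "v' \<in> V" by (rule near_relpow_subset[OF step.prems(1,3) near])
      fix w assume reach': "wreach (zero_edges V L (cut_ball P' B)) (one_edges (cut_ball P' B)) r v' w"
      have "snd (cut_ball P' B) \<subseteq> V" using cut unfolding cut_flip_def by blast
      from wreach_normal_form[OF reach' trans_zero_edges[OF this]]
      obtain m where m: "m \<le> r" "(v', w) \<in> (zero_edges V L (cut_ball P' B))\<^sup>= O
          (one_edges (cut_ball P' B) O (zero_edges V L (cut_ball P' B))\<^sup>=) ^^ m" by blast
      have "(v', w) \<in> near P' ^^ Suc (2 * m)"
        using stays_near_in_cut_ball[OF ball(1) step.prems(3) near q m(1)] m(2) unfolding B_def by blast
      then show "(v', w) \<in> near P' ^^ q" by (rule near_relpow_pad[OF P' v']) (use m(1) q in simp)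
    qed
    then show "\<forall>v'. wreach (zero_edges V L C) (one_edges C) r v v' \<longrightarrow>
      oisolated V L (cut_ball P' B) v' \<or> ordered_wins_from V E L r (tww_width q d) (cut_ball P' B) v'" by blast
  qed
qed

lemma near_trivial_partition: "near {V} = V \<times> V"
  unfolding near_def by auto

theorem flipper_wins_if_tww_at_most:
  assumes "tww_at_most V E L d"
  shows "flipper_wins r (tww_width r d) V E L"
proof -
  have "flipper_wins_from V E L r (tww_width r d) (E, L) v" if v: "v \<in> V" for v
  proof (rule flipper_wins_from_partition)
    have ne: "V \<noteq> {}" using v by blast
    show "(bounded_split E L d)\<^sup>*\<^sup>* {V} ((\<lambda>v. {v}) ` V)"
      using assms tww_at_most_iff_bounded_splits[OF ne] by blast
    show part: "partition_on V {V}" using ne by (simp add: partition_on_space)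
    fix v' assume "(v, v') \<in> (\<Union>i\<in>{..r}. gaifman (E, L) ^^ i)"
    then obtain i where i: "i \<le> r" "(v, v') \<in> gaifman (E, L) ^^ i" by blast
    \<comment> \<open>All of \<open>V\<close> is one part, so \<open>near {V}\<close> contains every
      pair and the invariant holds at the start.\<close>
    have "gaifman (E, L) \<subseteq> near {V}"
      unfolding gaifman_def near_trivial_partition using E_subset L_subset by auto
    then have "(v, v') \<in> near {V} ^^ i" by (rule relpow_mono) (rule i(2))
    then show "(v, v') \<in> near {V} ^^ r" by (rule near_relpow_pad[OF part v _ i(1)])
  qed (use v in simp_all)
  then show ?thesis unfolding flipper_wins_def by blast
qed

theorem ordered_flipper_wins_if_tww_at_most:
  assumes "tww_at_most V E L d"
  shows "ordered_flipper_wins r (tww_width (Suc (2 * r)) d) V E L"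
proof -
  define k where "k = tww_width (Suc (2 * r)) d"
  have "1 \<le> k" unfolding k_def width_bound_def by simp
  \<comment> \<open>The first announcement leaves the graph unchanged and cuts nowhere. The empty
    set admits only the empty partition.\<close>
  define P where "P = (if V = {} then {} else {V})"
  have "partition_on V P" "card P \<le> k"
    unfolding P_def using \<open>1 \<le> k\<close> by (auto simp: partition_on_space partition_on_empty)
  then have C: "cut_flip V E k (E, {})"
    unfolding cut_flip_def by (intro conjI exI[of _ P] exI[of _ "{}"]) auto
  have "ordered_wins_from V E L r k (E, {}) v" if v: "v \<in> V" for v
    unfolding k_def
  proof (rule ordered_wins_from_partition[OF _ HOL.refl])
    have ne: "V \<noteq> {}" using v by blast
    show "(bounded_split E L d)\<^sup>*\<^sup>* {V} ((\<lambda>v. {v}) ` V)"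
      using assms tww_at_most_iff_bounded_splits[OF ne] by blast
    show part: "partition_on V {V}" using ne by (simp add: partition_on_space)
    fix v' assume "wreach (zero_edges V L (E, {})) (one_edges (E, {})) r v v'"
    then have "v \<in> V \<longrightarrow> v' \<in> V"
      by induction (auto simp: zero_edges_def one_edges_def dest: E_subset)
    then have "(v, v') \<in> near {V} ^^ 1" using v unfolding near_trivial_partition by simp
    then show "(v, v') \<in> near {V} ^^ Suc (2 * r)" by (rule near_relpow_pad[OF part v]) simp
  qed (use v in simp_all)
  then show ?thesis using C unfolding ordered_flipper_wins_def k_def by blast
qed

section \<open>Inequalities between the parameters\<close>

lemma fw_le_twin_width: "fw r V E L \<le> tww_width r (twin_width V E L)"
  unfolding fw_def by (rule Least_le[where P = "\<lambda>k. flipper_wins r k V E L", OF flipper_wins_if_tww_at_most[OF tww_at_most_twin_width]])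

lemma ofw_le_twin_width: "ofw r V E L \<le> tww_width (Suc (2 * r)) (twin_width V E L)"
  unfolding ofw_def by (rule Least_le[where P = "\<lambda>k. ordered_flipper_wins r k V E L", OF ordered_flipper_wins_if_tww_at_most[OF tww_at_most_twin_width]])

text \<open>The minimum defining \<open>fw\<close> is attained because twin-width already provides
  some winning width.\<close>

lemma ofw_1_le_fw_5: "ofw 1 V E L \<le> fw 5 V E L"
proof -
  have "flipper_wins 5 (fw 5 V E L) V E L"
    unfolding fw_def by (rule LeastI[where P = "\<lambda>k. flipper_wins 5 k V E L", OF flipper_wins_if_tww_at_most[OF tww_at_most_twin_width]])
  then show ?thesis
    unfolding ofw_def by (rule Least_le[where P = "\<lambda>k. ordered_flipper_wins 1 k V E L", OF ordered_flipper_wins_if_flipper_wins])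
qed

lemma twin_width_le_ofw_1: "twin_width V E L \<le> degree_bound (3 * Suc (ofw 1 V E L))"
proof -
  have "ordered_flipper_wins 1 (ofw 1 V E L) V E L"
    unfolding ofw_def by (rule LeastI[where P = "\<lambda>k. ordered_flipper_wins 1 k V E L", OF ordered_flipper_wins_if_tww_at_most[OF tww_at_most_twin_width]])
  then show ?thesis
    unfolding twin_width_def by (rule Least_le[where P = "tww_at_most V E L", OF tww_at_most_if_ordered_flipper_wins])
qed

end

lemma bounded_transfer:
  fixes f g :: "'b \<Rightarrow> nat" and h :: "nat \<Rightarrow> nat"
  assumes "\<And>x. x \<in> C \<Longrightarrow> f x \<le> h (g x)" and "\<exists>d. \<forall>x\<in>C. g x \<le> d"
  shows "\<exists>d. \<forall>x\<in>C. f x \<le> d"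
proof -
  obtain d where d: "\<forall>x\<in>C. g x \<le> d" using assms(2) by blast
  \<comment> \<open>\<open>h\<close> is not assumed monotone, hence the maximum over all arguments
    up to \<open>d\<close>.\<close>
  have "f x \<le> Max (h ` {..d})" if "x \<in> C" for x
    using assms(1)[OF that] Max_ge[of "h ` {..d}" "h (g x)"] d that by fastforce
  then show ?thesis by blast
qed

theorem mainTheorem12:
  fixes C :: "('a set \<times> 'a rel \<times> 'a rel) set"
  assumes "\<forall>(V, E, L)\<in>C. ordered_graph V E L"
  shows "((\<exists>d. \<forall>(V, E, L)\<in>C. twin_width V E L \<le> d) \<longleftrightarrow>
            (\<forall>r. \<exists>d. \<forall>(V, E, L)\<in>C. fw r V E L \<le> d))
       \<and> ((\<exists>d. \<forall>(V, E, L)\<in>C. twin_width V E L \<le> d) \<longleftrightarrow>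
            (\<exists>d. \<forall>(V, E, L)\<in>C. fw 5 V E L \<le> d))
       \<and> ((\<exists>d. \<forall>(V, E, L)\<in>C. twin_width V E L \<le> d) \<longleftrightarrow>
            (\<forall>r. \<exists>d. \<forall>(V, E, L)\<in>C. ofw r V E L \<le> d))
       \<and> ((\<exists>d. \<forall>(V, E, L)\<in>C. twin_width V E L \<le> d) \<longleftrightarrow>
            (\<exists>d. \<forall>(V, E, L)\<in>C. ofw 1 V E L \<le> d))"
proof -
  let ?tww = "\<lambda>(V, E, L). twin_width V E L" and ?fw = "\<lambda>r (V, E, L). fw r V E L"
    and ?ofw = "\<lambda>r (V, E, L). ofw r V E L"
  let ?bounded = "\<lambda>f :: 'a set \<times> 'a rel \<times> 'a rel \<Rightarrow> nat. \<exists>d. \<forall>x\<in>C. f x \<le> d"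
  have og: "fin_ordered_graph V E L" if "(V, E, L) \<in> C" for V E L
    using that assms by (auto simp: fin_ordered_graph_def)
  have fw: "?bounded (?fw r)" if "?bounded ?tww" for r
    using fin_ordered_graph.fw_le_twin_width[OF og]
    by (intro bounded_transfer[OF _ that, of _ "tww_width r"]) auto
  have ofw: "?bounded (?ofw r)" if "?bounded ?tww" for r
    using fin_ordered_graph.ofw_le_twin_width[OF og]
    by (intro bounded_transfer[OF _ that, of _ "tww_width (Suc (2 * r))"]) auto
  have fw_5: "?bounded (?ofw 1)" if "?bounded (?fw 5)"
    using fin_ordered_graph.ofw_1_le_fw_5[OF og]
    by (intro bounded_transfer[OF _ that, of _ id]) auto
  have ofw_1: "?bounded ?tww" if "?bounded (?ofw 1)"
    using fin_ordered_graph.twin_width_le_ofw_1[OF og]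
    by (intro bounded_transfer[OF _ that, of _ "\<lambda>k. degree_bound (3 * Suc k)"]) auto
  have split: "(\<forall>x\<in>C. (case x of (V, E, L) \<Rightarrow> f V E L) \<le> d) \<longleftrightarrow> (\<forall>(V, E, L)\<in>C. f V E L \<le> d)"
    for f :: "'a set \<Rightarrow> 'a rel \<Rightarrow> 'a rel \<Rightarrow> nat" and d
    by (simp add: case_prod_unfold)
  \<comment> \<open>Bounded twin-width \<open>a\<close> gives all \<open>b r\<close> and
    \<open>c r\<close>; these specialise to \<open>b 5\<close> and \<open>c 1\<close>, and
    \<open>b 5\<close> gives \<open>c 1\<close>, which leads back to \<open>a\<close>.\<close>
  have cycle: "(a \<longleftrightarrow> (\<forall>r. b r)) \<and> (a \<longleftrightarrow> b 5) \<and> (a \<longleftrightarrow> (\<forall>r. c r)) \<and> (a \<longleftrightarrow> c 1)"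
    if "\<And>r. a \<Longrightarrow> b r" "\<And>r. a \<Longrightarrow> c r" "b 5 \<Longrightarrow> c 1" "c 1 \<Longrightarrow> a" for a and b c :: "nat \<Rightarrow> bool"
    using that by blast
  show ?thesis
    using cycle[of "?bounded ?tww" "\<lambda>r. ?bounded (?fw r)" "\<lambda>r. ?bounded (?ofw r)"] fw ofw fw_5 ofw_1
    unfolding split by argo
qed

end
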